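(* Let $X,Y$ be real Hilbert spaces and $F:X\to Y$ a bounded linear operator. For $N\in\mathbb N$, $N\ge1$, and data $y\in Y$ let $u_N=u_N(y)\in X$ be the iterate defined in the context. Let $\mu>0$ and let $u^\dagger\in X$ satisfy the source condition $$\exists\,\omega\in X:\quad u^\dagger=(F^*F)^\mu\omega .$$ (i) If the data are exact, $y=Fu^\dagger$, then there is a constant $C_\mu$, independent of $N$, such that $$\|u_N-u^\dagger\|\le C_\mu N^{-2\mu}.$$ (ii) Let $y=Fu^\dagger$, let the data be contaminated with noise, i.e. let $y_\delta\in Y$ with $\|y-y_\delta\|\le\delta$, and let $u_{N,\delta}:=u_N(y_\delta)$. Then there are constants $C_\mu,C$, independent of $N$ and $\delta$, such that $$\|u_{N,\delta}-u^\dagger\|\le C_\mu N^{-2\mu}+C\,\delta N .$$ The choice $N=N(\delta)\sim\delta^{-\frac{1}{2\mu+1}}$ (i.e. $c_1\delta^{-\frac{1}{2\mu+1}}\le N(\delta)\le c_2\delta^{-\frac{1}{2\mu+1}}$ with constants $c_1,c_2>0$) yields the convergence rate $$\|u_{N(\delta),\delta}-u^\dagger\|=O\big(\delta^{\frac{2\mu}{2\mu+1}}\big)\qquad\text{as }\delta\to0.$$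
   Context: Definition of $u_N$. For fixed $N\in\mathbb N$ define operators by $S_N:=I$ and, for $k=N-1,\dots,0$, $$K_k:=(F^*S_{k+1}F+I)^{-1}F^*S_{k+1},\qquad S_k:=(I-FK_k)^*S_{k+1}(I-FK_k)+K_k^*K_k+I .$$ For $y\in Y$ set $\epsilon_0:=-y$ and, for $k=0,\dots,N-1$, $$v_k:=-K_k\epsilon_k,\qquad \epsilon_{k+1}:=\epsilon_k+Fv_k ,$$ and let $u_N=u_N(y):=\sum_{j=0}^{N-1}v_j$. (Equivalently, the iteration $u_{k+1}=u_k+v_k$ with $u_0=0$; all quantities depend on $N$.) The powers $(F^*F)^\mu$ are defined by the spectral calculus. *)

theory Defs
  imports
    "HOL-Analysis.Analysis"
    "HOL-Computational_Algebra.Polynomial"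
    "HOL-Library.Landau_Symbols"
begin

section \<open>Bounded operators between real Hilbert spaces\<close>

text \<open>
  Real Hilbert spaces are types of sort \<open>{real_inner, complete_space}\<close>, bounded linear
  operators are elements of the type \<open>\<Rightarrow>\<^sub>L\<close>, whose norm is the operator norm.
\<close>

text \<open>
  The library constant \<open>adjoint\<close> picks some map \<open>g\<close> with \<open>f x \<bullet> y = x \<bullet> g y\<close>. For bounded \<open>f\<close>
  on a Hilbert space it exists by Riesz representation, is unique and is bounded linear.
\<close>

definition adj ::
    "('a::{real_inner, complete_space} \<Rightarrow>\<^sub>L 'b::{real_inner, complete_space}) \<Rightarrow> ('b \<Rightarrow>\<^sub>L 'a)" where
  "adj T = Blinfun (adjoint (blinfun_apply T))"

text \<open>Only meaningful if \<open>T\<close> is bijective; the inverse is then bounded.\<close>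

definition op_inverse :: "('a::real_normed_vector \<Rightarrow>\<^sub>L 'a) \<Rightarrow> ('a \<Rightarrow>\<^sub>L 'a)" where
  "op_inverse T = Blinfun (inv (blinfun_apply T))"


section \<open>Spectral calculus for self-adjoint operators\<close>

text \<open>
  The real spectrum. For self-adjoint operators this is the whole spectrum (of the
  complexification).
\<close>

definition op_spectrum :: "('a::real_normed_vector \<Rightarrow>\<^sub>L 'a) \<Rightarrow> real set" where
  "op_spectrum A =
     {t. \<not> (\<exists>B. B o\<^sub>L (A - t *\<^sub>R id_blinfun) = id_blinfun \<and>
                 (A - t *\<^sub>R id_blinfun) o\<^sub>L B = id_blinfun)}"

definition op_power :: "('a::real_normed_vector \<Rightarrow>\<^sub>L 'a) \<Rightarrow> nat \<Rightarrow> ('a \<Rightarrow>\<^sub>L 'a)" where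
  "op_power A n = ((\<lambda>B. A o\<^sub>L B) ^^ n) id_blinfun"

definition op_poly :: "real poly \<Rightarrow> ('a::real_normed_vector \<Rightarrow>\<^sub>L 'a) \<Rightarrow> ('a \<Rightarrow>\<^sub>L 'a)" where
  "op_poly p A = (\<Sum>i\<le>degree p. coeff p i *\<^sub>R op_power A i)"

text \<open>
  Continuous functional calculus: for self-adjoint \<open>A\<close> the map \<open>p \<mapsto> p(A)\<close> is isometric from
  polynomials with the supremum norm on the spectrum to operators with the operator norm, and
  \<open>f \<mapsto> f(A)\<close> is its extension by continuity to all \<open>f\<close> continuous on the spectrum.
\<close>

definition fun_calc :: "(real \<Rightarrow> real) \<Rightarrow> ('a::{real_inner, complete_space} \<Rightarrow>\<^sub>L 'a) \<Rightarrow> ('a \<Rightarrow>\<^sub>L 'a)" where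
  "fun_calc f A =
     (THE B. \<forall>p :: nat \<Rightarrow> real poly.
        uniform_limit (op_spectrum A) (\<lambda>n. poly (p n)) f sequentially \<longrightarrow>
        (\<lambda>n. op_poly (p n) A) \<longlonglongrightarrow> B)"

text \<open>For positive \<open>A\<close> the spectrum lies in the nonnegative reals; note \<open>0 powr \<mu> = 0\<close>.\<close>

definition op_powr :: "('a::{real_inner, complete_space} \<Rightarrow>\<^sub>L 'a) \<Rightarrow> real \<Rightarrow> ('a \<Rightarrow>\<^sub>L 'a)" where
  "op_powr A \<mu> = fun_calc (\<lambda>t. t powr \<mu>) A"


section \<open>The iteration\<close>

text \<open>\<open>gain F S\<close> is \<open>(F\<^sup>* S F + I)\<^sup>-\<^sup>1 F\<^sup>* S\<close>, so that \<open>K\<^sub>k = gain F S\<^sub>k\<^sub>+\<^sub>1\<close>.\<close>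

definition gain ::
    "('x::{real_inner, complete_space} \<Rightarrow>\<^sub>L 'y::{real_inner, complete_space})
      \<Rightarrow> ('y \<Rightarrow>\<^sub>L 'y) \<Rightarrow> ('y \<Rightarrow>\<^sub>L 'x)" where
  "gain F S = op_inverse ((adj F o\<^sub>L S o\<^sub>L F) + id_blinfun) o\<^sub>L (adj F o\<^sub>L S)"

text \<open>Backward recursion from \<open>S\<^sub>N = I\<close>; the (irrelevant) values for \<open>k > N\<close> are also \<open>I\<close>.\<close>

function S_op ::
    "('x::{real_inner, complete_space} \<Rightarrow>\<^sub>L 'y::{real_inner, complete_space})
      \<Rightarrow> nat \<Rightarrow> nat \<Rightarrow> ('y \<Rightarrow>\<^sub>L 'y)" where
  "S_op F N k =
     (if k < N then
        (let S = S_op F N (Suc k); K = gain F S in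
           (adj (id_blinfun - (F o\<^sub>L K)) o\<^sub>L S o\<^sub>L (id_blinfun - (F o\<^sub>L K)))
           + (adj K o\<^sub>L K) + id_blinfun)
      else id_blinfun)"
  by pat_completeness auto
termination
  by (relation "Wellfounded.measure (\<lambda>(F, N, k). N - k)") auto

declare S_op.simps [simp del]

definition K_op ::
    "('x::{real_inner, complete_space} \<Rightarrow>\<^sub>L 'y::{real_inner, complete_space})
      \<Rightarrow> nat \<Rightarrow> nat \<Rightarrow> ('y \<Rightarrow>\<^sub>L 'x)" where
  "K_op F N k = gain F (S_op F N (Suc k))"

primrec eps ::
    "('x::{real_inner, complete_space} \<Rightarrow>\<^sub>L 'y::{real_inner, complete_space})
      \<Rightarrow> nat \<Rightarrow> 'y \<Rightarrow> nat \<Rightarrow> 'y" where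
  "eps F N y 0 = - y"
| "eps F N y (Suc k) = eps F N y k + F (- K_op F N k (eps F N y k))"

definition v_step ::
    "('x::{real_inner, complete_space} \<Rightarrow>\<^sub>L 'y::{real_inner, complete_space})
      \<Rightarrow> nat \<Rightarrow> 'y \<Rightarrow> nat \<Rightarrow> 'x" where
  "v_step F N y k = - K_op F N k (eps F N y k)"

definition u_iter ::
    "('x::{real_inner, complete_space} \<Rightarrow>\<^sub>L 'y::{real_inner, complete_space})
      \<Rightarrow> nat \<Rightarrow> 'y \<Rightarrow> 'x" where
  "u_iter F N y = (\<Sum>j<N. v_step F N y j)"

end

theory Submission
  imports Defs "HOL-Computational_Algebra.Fundamental_Theorem_Algebra"
begin

text \<open>
  Put \<open>A = F\<^sup>* F\<close> and \<open>W\<^sub>k = F\<^sup>* S\<^sub>k F\<close>. The Riccati recursion for \<open>S\<^sub>k\<close> becomes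
  \<open>W\<^sub>k = (I + W\<^sub>k\<^sub>+\<^sub>1)\<^sup>-\<^sup>1 W\<^sub>k\<^sub>+\<^sub>1 + A\<close>, so \<open>W\<^sub>k = r\<^sub>m(A) / q\<^sub>m(A)\<close> with \<open>m = N - k\<close> for explicit polynomials,
  and for exact data the errors satisfy \<open>(I + W\<^sub>k\<^sub>+\<^sub>1) e\<^sub>k\<^sub>+\<^sub>1 = e\<^sub>k\<close>. The factors telescope to
  \<open>q\<^sub>N(A) (u\<^sub>N - u\<^sup>\<dagger>) = - u\<^sup>\<dagger>\<close>. Since \<open>q\<^sub>N(t) \<ge> (1 + sqrt t)\<^sup>N / 2\<close>, the quotient \<open>t\<^sup>\<mu> / q\<^sub>N(t)\<close> is
  \<open>O(N\<^sup>-\<^sup>2\<^sup>\<mu>)\<close> on bounded intervals, and the spectral calculus transfers this to operators.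

  For the noise, the iteration is the optimal control of \<open>\<epsilon>\<^sub>k\<^sub>+\<^sub>1 = \<epsilon>\<^sub>k + F v\<^sub>k\<close>, hence \<open>\<Sum> \<parallel>v\<^sub>k\<parallel>\<^sup>2\<close> is at
  most the cost \<open>(N + 1) \<parallel>y\<parallel>\<^sup>2\<close> of the control \<open>v = 0\<close>, and Cauchy-Schwarz gives
  \<open>\<parallel>u\<^sub>N(y)\<parallel> \<le> 2 N \<parallel>y\<parallel>\<close>; the iterate is linear in the data.

  The spectral calculus over the reals rests on \<open>\<parallel>p(A)\<parallel> \<le> sup |p|\<close> over the real spectrum: if
  \<open>l = \<parallel>p(A)\<parallel>\<close> exceeded this supremum, then \<open>p\<^sup>2 - l\<^sup>2\<close> would have no zero in the spectrum, so that,
  factor by factor, \<open>p(A)\<^sup>2 - l\<^sup>2\<close> would be bounded below, although \<open>l\<close> or \<open>-l\<close> is an approximate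
  eigenvalue of \<open>p(A)\<close>.
\<close>

section \<open>Operators on real Hilbert spaces\<close>

text \<open>The representing vector minimises \<open>J\<close>: boundedness of \<open>\<phi>\<close>
  bounds \<open>J\<close> below, the parallelogram law makes a minimising sequence Cauchy, and the
  first variation vanishes at its limit.\<close>

lemma riesz_representation:
  fixes \<phi> :: "'a::{real_inner, complete_space} \<Rightarrow> real"
  assumes "bounded_linear \<phi>"
  obtains z where "\<And>x. \<phi> x = x \<bullet> z"
proof -
  interpret \<phi>: bounded_linear \<phi> by fact
  define J where "J = (\<lambda>x. x \<bullet> x - 2 * \<phi> x)"
  obtain K where K: "\<And>x. norm (\<phi> x) \<le> norm x * K"
    using \<phi>.bounded by blast
  have lower: "- K\<^sup>2 \<le> J x" for x
  proof -
    have "\<phi> x \<le> norm x * K" using K[of x] by simp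
    moreover have "0 \<le> (norm x - K)\<^sup>2" by simp
    ultimately show ?thesis
      by (simp add: J_def power2_norm_eq_inner[symmetric] power2_eq_square algebra_simps)
  qed
  define m where "m = Inf (range J)"
  have bdd: "bdd_below (range J)" using lower by (intro bdd_belowI[of _ "- K\<^sup>2"]) auto
  have m_le: "m \<le> J x" for x
    unfolding m_def using bdd by (simp add: cInf_lower)
  have "\<exists>x. J x < m + inverse (real (Suc n))" for n
    using cInf_lessD[of "range J" "m + inverse (real (Suc n))"] by (force simp: m_def)
  then obtain X where X: "\<And>n. J (X n) < m + inverse (real (Suc n))"
    by metis
  have J_parallelogram: "(norm (x - y))\<^sup>2 = 2 * J x + 2 * J y - 4 * J ((1/2) *\<^sub>R (x + y))" for x y
    by (simp add: J_def power2_norm_eq_inner inner_simps \<phi>.scaleR \<phi>.add inner_commute algebra_simps)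
  have dist_bound: "(norm (X i - X j))\<^sup>2 \<le> 2 * inverse (real (Suc i)) + 2 * inverse (real (Suc j))" for i j
    using J_parallelogram[of "X i" "X j"] X[of i] X[of j] m_le[of "(1/2) *\<^sub>R (X i + X j)"] by linarith
  have "Cauchy X"
  proof (rule metric_CauchyI)
    fix e :: real assume e: "0 < e"
    then have "0 < e\<^sup>2 / 4" by simp
    then obtain n where n: "inverse (real (Suc n)) < e\<^sup>2 / 4"
      using reals_Archimedean by blast
    have "dist (X i) (X j) < e" if "n \<le> i" "n \<le> j" for i j
    proof -
      have "inverse (real (Suc k)) \<le> inverse (real (Suc n))" if "n \<le> k" for k
        using that by (intro le_imp_inverse_le) auto
      from this[of i] this[of j] have "(norm (X i - X j))\<^sup>2 < e\<^sup>2"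
        using dist_bound[of i j] n that by linarith
      then show ?thesis using e by (simp add: dist_norm power2_less_imp_less)
    qed
    then show "\<exists>M. \<forall>i\<ge>M. \<forall>j\<ge>M. dist (X i) (X j) < e" by blast
  qed
  then obtain z where z: "X \<longlonglongrightarrow> z" using Cauchy_convergent convergent_def by blast
  have "(\<lambda>n. J (X n)) \<longlonglongrightarrow> J z"
    unfolding J_def by (intro tendsto_intros z \<phi>.tendsto)
  moreover have "(\<lambda>n. m + inverse (real (Suc n))) \<longlonglongrightarrow> m + 0"
    by (intro tendsto_intros LIMSEQ_inverse_real_of_nat)
  ultimately have "J z \<le> m + 0"
    by (rule LIMSEQ_le) (use X in \<open>auto intro: less_imp_le\<close>)
  then have min: "J z \<le> J x" for x using m_le[of x] by simp
  have "\<phi> h = h \<bullet> z" for h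
  proof (rule ccontr)
    assume ne: "\<phi> h \<noteq> h \<bullet> z"
    define b where "b = h \<bullet> z - \<phi> h"
    \<comment> \<open>The best step along \<open>h\<close> would be
      \<open>- b / (h \<bullet> h)\<close>; adding 1 keeps the denominator positive, and
      \<open>J\<close> still drops strictly because \<open>b\<close> is nonzero.\<close>
    define d where "d = h \<bullet> h + 1"
    have d: "d > 0" unfolding d_def using inner_ge_zero[of h] by linarith
    have "J (z + (- b / d) *\<^sub>R h) - J z = (b / d)\<^sup>2 * (d - 1) - 2 * (b / d) * b"
      by (simp add: J_def b_def d_def inner_simps \<phi>.scaleR \<phi>.add \<phi>.diff \<phi>.neg inner_commute
          power2_eq_square algebra_simps diff_divide_distrib)
    also have "\<dots> = - (b\<^sup>2 / d + (b / d)\<^sup>2)"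
      using d by (simp add: field_simps power2_eq_square)
    also have "\<dots> < 0"
    proof -
      have "0 < b\<^sup>2 / d" using d ne by (simp add: b_def)
      then show ?thesis using zero_le_power2[of "b / d"] by linarith
    qed
    finally show False using min[of "z + (- b / d) *\<^sub>R h"] by linarith
  qed
  then show ?thesis by (rule that)
qed

text \<open>Riesz yields a representing map \<open>g\<close>; uniqueness identifies it with the
  choice made by \<open>adjoint\<close>, and boundedness lets \<open>Blinfun\<close> wrap it
  faithfully.\<close>

lemma adj_inner_right: "x \<bullet> adj T y = T x \<bullet> y"
  and adj_inner_left: "adj T y \<bullet> x = y \<bullet> T x"
  for T :: "'a::{real_inner, complete_space} \<Rightarrow>\<^sub>L 'b::{real_inner, complete_space}"
proof -
  have "\<exists>w. \<forall>x. T x \<bullet> y = x \<bullet> w" for y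
  proof -
    have "bounded_linear (\<lambda>x. T x \<bullet> y)"
      by (intro bounded_linear_intros)
    then show ?thesis using riesz_representation by metis
  qed
  then obtain g where g: "\<And>x y. T x \<bullet> y = x \<bullet> g y" by metis
  have "adjoint (blinfun_apply T) = g"
    by (rule adjoint_unique) (use g in auto)
  moreover have "bounded_linear g"
  proof
    show "g (x + y) = g x + g y" for x y
      by (rule vector_eq_ldot[THEN iffD1]) (simp add: g[symmetric] inner_simps)
    show "g (r *\<^sub>R x) = r *\<^sub>R g x" for r x
      by (rule vector_eq_ldot[THEN iffD1]) (simp add: g[symmetric] inner_simps)
    have "norm (g y) \<le> norm y * norm T" for y
    proof -
      have "(norm (g y))\<^sup>2 = T (g y) \<bullet> y"
        by (simp add: g power2_norm_eq_inner)
      also have "\<dots> \<le> norm (T (g y)) * norm y" by (rule norm_cauchy_schwarz)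
      also have "\<dots> \<le> (norm T * norm (g y)) * norm y"
        by (intro mult_right_mono norm_blinfun) auto
      finally have "norm (g y) * norm (g y) \<le> norm (g y) * (norm y * norm T)"
        by (simp add: power2_eq_square algebra_simps)
      then show ?thesis
        by (cases "norm (g y) = 0") (auto simp: mult_le_cancel_left)
    qed
    then show "\<exists>K. \<forall>x. norm (g x) \<le> norm x * K" by blast
  qed
  ultimately have "blinfun_apply (adj T) = g"
    by (simp add: adj_def bounded_linear_Blinfun_apply)
  then show "x \<bullet> adj T y = T x \<bullet> y" "adj T y \<bullet> x = y \<bullet> T x"
    using g by (auto simp: inner_commute)
qed

text \<open>Lax-Milgram by Banach's fixed point theorem: \<open>M x = y\<close> holds exactly at the
  fixed points of \<open>f\<close>, a contraction for suitable \<open>\<tau>\<close>.\<close>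

lemma coercive_imp_surj:
  fixes M :: "'a::{real_inner, complete_space} \<Rightarrow>\<^sub>L 'a"
  assumes c: "c > 0" and coercive: "\<And>x. c * (norm x)\<^sup>2 \<le> M x \<bullet> x"
  shows "surj M"
proof -
  have "\<exists>x. M x = y" for y
  proof -
    define k where "k = norm M + c"
    have k: "k > 0" "c \<le> k" using c by (auto simp: k_def add_nonneg_pos)
    \<comment> \<open>This value minimises
      \<open>1 - 2 * \<tau> * c + \<tau>\<^sup>2 * k\<^sup>2\<close>. Including \<open>c\<close> in
      \<open>k\<close> gives \<open>c / k \<le> 1\<close>, so the minimum has a real square
      root.\<close>
    define \<tau> where "\<tau> = c / k\<^sup>2"
    define f where "f = (\<lambda>x. x - \<tau> *\<^sub>R (M x - y))"
    have \<tau>: "\<tau> > 0" using c k by (simp add: \<tau>_def)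
    have contract: "(norm (x - \<tau> *\<^sub>R M x))\<^sup>2 \<le> (1 - (c / k)\<^sup>2) * (norm x)\<^sup>2" for x
    proof -
      have "norm (M x) \<le> k * norm x"
        using norm_blinfun[of M x] c by (simp add: k_def distrib_right add_increasing2)
      then have "(norm (M x))\<^sup>2 \<le> (k * norm x)\<^sup>2" by (rule power_mono) simp
      then have 1: "\<tau>\<^sup>2 * (norm (M x))\<^sup>2 \<le> \<tau>\<^sup>2 * (k\<^sup>2 * (norm x)\<^sup>2)"
        by (intro mult_left_mono) (auto simp: power_mult_distrib)
      have 2: "2 * \<tau> * (c * (norm x)\<^sup>2) \<le> 2 * \<tau> * (M x \<bullet> x)"
        using \<tau> by (intro mult_left_mono coercive) auto
      have "(norm (x - \<tau> *\<^sub>R M x))\<^sup>2 = (norm x)\<^sup>2 - 2 * \<tau> * (M x \<bullet> x) + \<tau>\<^sup>2 * (norm (M x))\<^sup>2"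
        unfolding power2_norm_eq_inner
        by (simp add: inner_diff_left inner_diff_right inner_commute power2_eq_square algebra_simps)
      also have "\<dots> \<le> (norm x)\<^sup>2 - 2 * \<tau> * (c * (norm x)\<^sup>2) + \<tau>\<^sup>2 * (k\<^sup>2 * (norm x)\<^sup>2)"
        using 1 2 by linarith
      also have "\<dots> = (1 - 2 * \<tau> * c + \<tau>\<^sup>2 * k\<^sup>2) * (norm x)\<^sup>2"
        by (simp add: algebra_simps)
      also have "1 - 2 * \<tau> * c + \<tau>\<^sup>2 * k\<^sup>2 = 1 - (c / k)\<^sup>2"
        using k by (simp add: \<tau>_def field_simps power2_eq_square)
      finally show ?thesis .
    qed
    define q where "q = sqrt (1 - (c / k)\<^sup>2)"
    have ck: "0 < c / k" "c / k \<le> 1" using c k by auto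
    then have "(c / k)\<^sup>2 \<le> 1" by (simp add: power_le_one)
    then have q: "0 \<le> q" "q < 1" "q\<^sup>2 = 1 - (c / k)\<^sup>2"
      using ck by (auto simp: q_def)
    have "dist (f a) (f b) \<le> q * dist a b" for a b
    proof -
      have "f a - f b = (a - b) - \<tau> *\<^sub>R M (a - b)"
        by (simp add: f_def blinfun.diff_right algebra_simps)
      then have "(dist (f a) (f b))\<^sup>2 \<le> (q * dist a b)\<^sup>2"
        using contract[of "a - b"] by (simp add: dist_norm power_mult_distrib q(3))
      then show ?thesis by (rule power2_le_imp_le) (simp add: q)
    qed
    then have "\<exists>!x\<in>UNIV. f x = x"
      by (intro Banach_fix[where c=q]) (use q in \<open>auto simp: complete_UNIV\<close>)
    then show ?thesis using \<tau> by (auto simp: f_def)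
  qed
  then show ?thesis by (metis surjI)
qed

definition self_adjoint :: "('a::real_inner \<Rightarrow>\<^sub>L 'a) \<Rightarrow> bool" where
  "self_adjoint A \<longleftrightarrow> (\<forall>x y. A x \<bullet> y = x \<bullet> A y)"

lemma self_adjointD: "self_adjoint A \<Longrightarrow> A x \<bullet> y = x \<bullet> A y"
  by (simp add: self_adjoint_def)

lemma bounded_below_inj:
  fixes T :: "'a::real_normed_vector \<Rightarrow>\<^sub>L 'b::real_normed_vector"
  assumes "c > 0" "\<And>x. c * norm x \<le> norm (T x)"
  shows "inj T"
proof (rule injI)
  fix x y assume "T x = T y"
  then have "c * norm (x - y) \<le> 0"
    using assms(2)[of "x - y"] by (simp add: blinfun.diff_right)
  then show "x = y" using assms(1) by (simp add: mult_le_0_iff)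
qed

text \<open>By self-adjointness the quadratic form of \<open>T o\<^sub>L T\<close> at
  \<open>x\<close> is the square of \<open>norm (T x)\<close>, so \<open>T o\<^sub>L T\<close> is
  coercive and hence onto.\<close>

lemma self_adjoint_bounded_below_surj:
  fixes T :: "'a::{real_inner, complete_space} \<Rightarrow>\<^sub>L 'a"
  assumes sa: "self_adjoint T" and c: "c > 0" and below: "\<And>x. c * norm x \<le> norm (T x)"
  shows "surj T"
proof -
  have "surj (T o\<^sub>L T)"
  proof (rule coercive_imp_surj)
    show "0 < c\<^sup>2" using c by simp
    show "c\<^sup>2 * (norm x)\<^sup>2 \<le> (T o\<^sub>L T) x \<bullet> x" for x
      using power_mono[OF below[of x], of 2] c
      by (simp add: self_adjointD[OF sa] power2_norm_eq_inner power_mult_distrib)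
  qed
  then show ?thesis by (auto simp: surj_def)
qed

text \<open>The lower bound makes \<open>T\<close> injective and \<open>inv T\<close> bounded by
  \<open>1 / c\<close>, so \<open>op_inverse\<close> is the true inverse.\<close>

lemma op_inverse_right:
  fixes T :: "'a::real_normed_vector \<Rightarrow>\<^sub>L 'a"
  assumes c: "c > 0" and below: "\<And>x. c * norm x \<le> norm (T x)" and surj: "surj T"
  shows "T (op_inverse T x) = x"
proof -
  have inj: "inj T" by (rule bounded_below_inj[OF c below])
  have Ti: "T (inv T x) = x" for x using surj by (rule surj_f_inv_f)
  have "bounded_linear (inv T)"
  proof
    show "inv T (x + y) = inv T x + inv T y" for x y
      by (rule injD[OF inj]) (simp add: Ti blinfun.add_right)
    show "inv T (r *\<^sub>R x) = r *\<^sub>R inv T x" for r x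
      by (rule injD[OF inj]) (simp add: Ti blinfun.scaleR_right)
    have "norm (inv T x) \<le> norm x * (1 / c)" for x
      using below[of "inv T x"] c by (simp add: Ti field_simps)
    then show "\<exists>K. \<forall>x. norm (inv T x) \<le> norm x * K" by blast
  qed
  then show ?thesis by (simp add: op_inverse_def bounded_linear_Blinfun_apply Ti)
qed

lemma op_inverse_left:
  fixes T :: "'a::real_normed_vector \<Rightarrow>\<^sub>L 'a"
  assumes c: "c > 0" and below: "\<And>x. c * norm x \<le> norm (T x)" and surj: "surj T"
  shows "op_inverse T (T x) = x"
  by (rule injD[OF bounded_below_inj[OF c below]]) (simp add: op_inverse_right[OF assms])

section \<open>Polynomials of self-adjoint operators\<close>

lemma op_power_0 [simp]: "op_power A 0 = id_blinfun"
  and op_power_Suc [simp]: "op_power A (Suc n) = A o\<^sub>L op_power A n"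
  by (simp_all add: op_power_def)

lemma op_poly_apply:
  assumes "degree p \<le> n"
  shows "op_poly p A x = (\<Sum>i\<le>n. coeff p i *\<^sub>R op_power A i x)"
proof -
  have "op_poly p A x = (\<Sum>i\<le>degree p. coeff p i *\<^sub>R op_power A i x)"
    by (simp add: op_poly_def blinfun.sum_left blinfun.scaleR_left)
  also have "\<dots> = (\<Sum>i\<le>n. coeff p i *\<^sub>R op_power A i x)"
    using assms by (intro sum.mono_neutral_left) (auto simp: coeff_eq_0)
  finally show ?thesis .
qed

lemma op_poly_0 [simp]: "op_poly 0 A x = 0"
  by (simp add: op_poly_def blinfun.scaleR_left)

lemma op_poly_pCons [simp]: "op_poly (pCons a p) A x = a *\<^sub>R x + A (op_poly p A x)"
proof -
  have "op_poly (pCons a p) A x = (\<Sum>i\<le>Suc (degree p). coeff (pCons a p) i *\<^sub>R op_power A i x)"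
    by (rule op_poly_apply) (rule degree_pCons_le)
  also have "\<dots> = a *\<^sub>R x + A (\<Sum>i\<le>degree p. coeff p i *\<^sub>R op_power A i x)"
    by (simp only: sum.atMost_Suc_shift) (simp add: blinfun.sum_right blinfun.scaleR_right)
  finally show ?thesis by (simp add: op_poly_apply[of p "degree p"])
qed

lemma op_poly_add [simp]: "op_poly (p + q) A x = op_poly p A x + op_poly q A x"
proof -
  let ?n = "max (degree p) (degree q)"
  have "degree (p + q) \<le> ?n" by (rule degree_add_le) auto
  then show ?thesis
    by (simp add: op_poly_apply[of _ ?n] scaleR_add_left sum.distrib)
qed

lemma op_poly_smult [simp]: "op_poly (smult c p) A x = c *\<^sub>R op_poly p A x"
  by (simp add: op_poly_apply[of _ "degree p"] degree_smult_le scaleR_sum_right)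

lemma op_poly_minus [simp]: "op_poly (- p) A x = - op_poly p A x"
  by (simp add: op_poly_apply[of _ "degree p"] sum_negf)

lemma op_poly_diff [simp]: "op_poly (p - q) A x = op_poly p A x - op_poly q A x"
  using op_poly_add[of p "- q" A x] by simp

lemma op_poly_mult [simp]: "op_poly (p * q) A x = op_poly p A (op_poly q A x)"
  by (induction p) (simp_all add: blinfun.add_left blinfun.add_right)

lemma op_poly_commute: "op_poly p A (op_poly q A x) = op_poly q A (op_poly p A x)"
  by (metis mult.commute op_poly_mult)

lemma op_poly_commute_self: "op_poly p A (A x) = A (op_poly p A x)"
  using op_poly_commute[of p A "[:0, 1:]" x] by simp

lemma self_adjoint_op_poly:
  assumes "self_adjoint A"
  shows "self_adjoint (op_poly p A)"
proof -
  have "op_poly p A x \<bullet> y = x \<bullet> op_poly p A y" for x y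
    by (induction p arbitrary: x y)
      (simp_all add: inner_simps self_adjointD[OF assms] op_poly_commute_self)
  then show ?thesis by (simp add: self_adjoint_def)
qed

section \<open>The real spectrum and bounds from below\<close>

lemma not_in_op_spectrum_bounded_below:
  fixes A :: "'a::real_normed_vector \<Rightarrow>\<^sub>L 'a"
  assumes "t \<notin> op_spectrum A"
  obtains c where "c > 0" "\<And>x. c * norm x \<le> norm (A x - t *\<^sub>R x)"
proof -
  obtain B where B: "B o\<^sub>L (A - t *\<^sub>R id_blinfun) = id_blinfun"
    using assms by (auto simp: op_spectrum_def)
  define k where "k = norm B + 1"
  have k: "k > 0" by (simp add: k_def add_nonneg_pos)
  have "inverse k * norm x \<le> norm (A x - t *\<^sub>R x)" for x
  proof -
    have "x = B (A x - t *\<^sub>R x)"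
      using arg_cong[OF B, of "\<lambda>T. blinfun_apply T x"]
      by (simp add: blinfun.diff_left blinfun.scaleR_left)
    then have "norm x \<le> norm B * norm (A x - t *\<^sub>R x)"
      by (metis norm_blinfun)
    also have "\<dots> \<le> k * norm (A x - t *\<^sub>R x)"
      by (intro mult_right_mono) (auto simp: k_def)
    finally show ?thesis using k by (simp add: field_simps)
  qed
  with k show ?thesis by (intro that[of "inverse k"]) auto
qed

text \<open>The shift by a real \<open>t\<close> stays self-adjoint, so the lower bound alone gives
  surjectivity and with it a bounded two-sided inverse.\<close>

lemma bounded_below_not_in_op_spectrum:
  fixes A :: "'a::{real_inner, complete_space} \<Rightarrow>\<^sub>L 'a"
  assumes sa: "self_adjoint A" and c: "c > 0"
    and below: "\<And>x. c * norm x \<le> norm (A x - t *\<^sub>R x)"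
  shows "t \<notin> op_spectrum A"
proof -
  let ?T = "A - t *\<^sub>R id_blinfun"
  have apply_T: "?T x = A x - t *\<^sub>R x" for x
    by (simp add: blinfun.diff_left blinfun.scaleR_left)
  have "self_adjoint ?T"
    by (auto simp: self_adjoint_def apply_T inner_simps self_adjointD[OF sa])
  moreover have below': "c * norm x \<le> norm (?T x)" for x
    using below by (simp add: apply_T)
  ultimately have "surj ?T"
    by (intro self_adjoint_bounded_below_surj[OF _ c])
  note op_inverse_right[OF c below' this] op_inverse_left[OF c below' this]
  then have "op_inverse ?T o\<^sub>L ?T = id_blinfun" "?T o\<^sub>L op_inverse ?T = id_blinfun"
    by (auto intro!: blinfun_eqI)
  then show ?thesis by (auto simp: op_spectrum_def)
qed

lemma op_spectrum_abs_le_norm: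
  fixes A :: "'a::{real_inner, complete_space} \<Rightarrow>\<^sub>L 'a"
  assumes "self_adjoint A" "t \<in> op_spectrum A"
  shows "\<bar>t\<bar> \<le> norm A"
proof (rule ccontr)
  assume "\<not> ?thesis"
  then have "\<bar>t\<bar> - norm A > 0" by simp
  moreover have "(\<bar>t\<bar> - norm A) * norm x \<le> norm (A x - t *\<^sub>R x)" for x
    using norm_triangle_ineq2[of "t *\<^sub>R x" "A x"] norm_blinfun[of A x]
    by (simp add: norm_minus_commute algebra_simps)
  ultimately show False
    using assms bounded_below_not_in_op_spectrum by blast
qed

lemma op_spectrum_nonneg:
  fixes A :: "'a::{real_inner, complete_space} \<Rightarrow>\<^sub>L 'a"
  assumes "self_adjoint A" "\<And>x. 0 \<le> A x \<bullet> x" "t \<in> op_spectrum A"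
  shows "0 \<le> t"
proof (rule ccontr)
  assume t: "\<not> ?thesis"
  have "- t * norm x \<le> norm (A x - t *\<^sub>R x)" for x
  proof (cases "x = 0")
    case False
    have "- t * norm x * norm x \<le> (A x - t *\<^sub>R x) \<bullet> x"
      using assms(2)[of x] by (simp add: inner_diff_left dot_square_norm power2_eq_square)
    also have "\<dots> \<le> norm (A x - t *\<^sub>R x) * norm x" by (rule norm_cauchy_schwarz)
    finally show ?thesis by (rule mult_right_le_imp_le) (use False in simp)
  qed simp
  with t assms show False
    using bounded_below_not_in_op_spectrum[of A "- t" t] by auto
qed

section \<open>Real factorisation and the norm bound for \<open>op_poly\<close>\<close>

lemma poly_of_real_mult:
  "poly (map_poly complex_of_real (p * q)) z
    = poly (map_poly of_real p) z * poly (map_poly of_real q) z"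
proof -
  have "map_poly complex_of_real (p * q) = map_poly of_real p * map_poly of_real q"
    by (rule poly_eqI) (simp add: coeff_map_poly coeff_mult)
  then show ?thesis by simp
qed

lemma poly_of_real_add:
  "poly (map_poly complex_of_real (p + q)) z
    = poly (map_poly of_real p) z + poly (map_poly of_real q) z"
proof -
  have "map_poly complex_of_real (p + q) = map_poly of_real p + map_poly of_real q"
    by (rule poly_eqI) (simp add: coeff_map_poly)
  then show ?thesis by simp
qed

lemma poly_of_real_of_real:
  "poly (map_poly complex_of_real p) (of_real r) = of_real (poly p r)"
  by (induction p) (simp_all add: map_poly_pCons)

text \<open>Take a complex root: a real one gives the linear factor, a nonreal one together with its
  conjugate the quadratic.\<close>

lemma real_poly_factor:
  fixes p :: "real poly"
  assumes "degree p > 0"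
  obtains (linear) r s where "p = [:- r, 1:] * s"
    | (quadratic) a b s where "b \<noteq> 0" "p = [:a\<^sup>2 + b\<^sup>2, - 2 * a, 1:] * s"
proof -
  have "degree (map_poly complex_of_real p) = degree p"
    by (rule degree_map_poly) auto
  then have "\<not> constant (poly (map_poly complex_of_real p))"
    using assms by (simp add: constant_degree)
  then obtain z where z: "poly (map_poly complex_of_real p) z = 0"
    using fundamental_theorem_of_algebra by blast
  show ?thesis
  proof (cases "Im z = 0")
    case True
    then have "z = of_real (Re z)" by (simp add: complex_eq_iff)
    then have "poly p (Re z) = 0"
      using z poly_of_real_of_real[of p "Re z"] by (metis of_real_eq_0_iff)
    then show ?thesis
      using linear by (auto simp: poly_eq_0_iff_dvd elim!: dvdE)
  next
    case False
    define m where "m = [:(Re z)\<^sup>2 + (Im z)\<^sup>2, - 2 * Re z, 1:]"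
    \<comment> \<open>The remainder is real of degree at most one and vanishes at the nonreal
      \<open>z\<close>, hence it is zero.\<close>
    define r where "r = p mod m"
    have "degree m = 2" "m \<noteq> 0" by (simp_all add: m_def)
    then have "degree r < 2"
      using degree_mod_less[of m p] by (auto simp: r_def)
    then have "r = [:coeff r 0, coeff r 1:]"
      by (intro poly_eqI) (auto simp: coeff_pCons coeff_eq_0 split: nat.splits)
    then obtain u v where r: "r = [:u, v:]" by blast
    have p: "p = m * (p div m) + r" by (simp add: r_def)
    have "poly (map_poly complex_of_real m) z = 0"
      by (simp add: m_def map_poly_pCons complex_eq_iff power2_eq_square algebra_simps)
    then have "poly (map_poly complex_of_real r) z = 0"
      using z by (subst (asm) p) (simp only: poly_of_real_mult poly_of_real_add, simp)
    then have "u + Re z * v = 0" "Im z * v = 0"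
      by (simp_all add: r map_poly_pCons complex_eq_iff)
    then have "r = 0" using False r by simp
    then show ?thesis
      using quadratic[OF False] p by (metis add.right_neutral m_def)
  qed
qed

text \<open>Lower bounds multiply along a factorisation. A linear factor has its root outside the
  spectrum; a quadratic \<open>(t - a)\<^sup>2 + b\<^sup>2\<close> is bounded below by
  \<open>b\<^sup>2\<close> because \<open>A\<close> is self-adjoint.\<close>

lemma op_poly_bounded_below:
  fixes A :: "'a::{real_inner, complete_space} \<Rightarrow>\<^sub>L 'a"
  assumes sa: "self_adjoint A" and "p \<noteq> 0" "\<And>t. t \<in> op_spectrum A \<Longrightarrow> poly p t \<noteq> 0"
  obtains c where "c > 0" "\<And>x. c * norm x \<le> norm (op_poly p A x)"
proof -
  have "\<exists>c>0. \<forall>x. c * norm x \<le> norm (op_poly p A x)"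
    using assms(2,3)
  proof (induction "degree p" arbitrary: p rule: less_induct)
    case less
    have product: "\<exists>c>0. \<forall>x. c * norm x \<le> norm (op_poly p A x)"
      if "p = m * s" "degree m > 0" "d > 0" "\<And>x. d * norm x \<le> norm (op_poly m A x)" for m s d
    proof -
      have "m \<noteq> 0" "s \<noteq> 0" using less.prems(1) that(1) by auto
      then have "degree s < degree p" using that(1,2) by (simp add: degree_mult_eq)
      moreover have "poly s t \<noteq> 0" if "t \<in> op_spectrum A" for t
        using less.prems(2)[OF that] \<open>p = m * s\<close> by simp
      ultimately obtain c where c: "c > 0" "\<And>x. c * norm x \<le> norm (op_poly s A x)"
        using less.hyps[of s] \<open>s \<noteq> 0\<close> by blast
      have "d * c * norm x \<le> norm (op_poly p A x)" for x
      proof -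
        have "d * (c * norm x) \<le> d * norm (op_poly s A x)"
          using that(3) c(2) by (intro mult_left_mono) auto
        also have "\<dots> \<le> norm (op_poly p A x)" using that(1,4) by simp
        finally show ?thesis by (simp add: mult.assoc)
      qed
      then show ?thesis using mult_pos_pos[OF that(3) c(1)] by blast
    qed
    show ?case
    proof (cases "degree p = 0")
      case True
      then obtain a where "p = [:a:]" using degree_eq_zeroE by blast
      then show ?thesis using less.prems(1)
        by (intro exI[of _ "\<bar>a\<bar>"]) (auto simp: blinfun.zero_right)
    next
      case False
      then have "degree p > 0" by simp
      then show ?thesis
      proof (cases rule: real_poly_factor)
        case (linear r s)
        then have "r \<notin> op_spectrum A" using less.prems(2) by force
        then obtain d where "d > 0" "\<And>x. d * norm x \<le> norm (A x - r *\<^sub>R x)"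
          using not_in_op_spectrum_bounded_below by blast
        then show ?thesis
          by (intro product[OF linear, of d]) (auto simp: blinfun.zero_right)
      next
        case (quadratic a b s)
        have "b\<^sup>2 * norm x \<le> norm (op_poly [:a\<^sup>2 + b\<^sup>2, - 2 * a, 1:] A x)" (is "_ \<le> norm ?y") for x
        proof (cases "x = 0")
          case False
          have "?y \<bullet> x = (norm (A x - a *\<^sub>R x))\<^sup>2 + b\<^sup>2 * (norm x)\<^sup>2"
            unfolding power2_norm_eq_inner
            by (simp add: inner_simps self_adjointD[OF sa] blinfun.add_right blinfun.diff_right
                blinfun.scaleR_right blinfun.zero_right inner_commute power2_eq_square algebra_simps)
          then have "b\<^sup>2 * norm x * norm x \<le> ?y \<bullet> x" by (simp add: power2_eq_square)
          also have "\<dots> \<le> norm ?y * norm x" by (rule norm_cauchy_schwarz)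
          finally show ?thesis by (rule mult_right_le_imp_le) (use False in simp)
        qed simp
        then show ?thesis
          by (intro product[OF quadratic(2), of "b\<^sup>2"]) (use quadratic(1) in auto)
      qed
    qed
  qed
  then show ?thesis using that by blast
qed

text \<open>In a nontrivial space \<open>norm B\<close> or its negative is an approximate eigenvalue of \<open>B\<close>.\<close>

lemma self_adjoint_square_bounded_below_trivial:
  fixes B :: "'a::real_inner \<Rightarrow>\<^sub>L 'a" and x :: 'a
  assumes sa: "self_adjoint B" and c: "c > 0"
    and below: "\<And>x. c * norm x \<le> norm (B (B x) - (norm B)\<^sup>2 *\<^sub>R x)"
  shows "x = 0"
proof (rule ccontr)
  assume x: "x \<noteq> 0"
  define l where "l = norm B"
  have l: "l > 0"
  proof (rule ccontr)
    assume "\<not> l > 0"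
    then have "B = 0" by (simp add: l_def)
    then show False using below[of x] c x by (simp add: mult_le_0_iff)
  qed
  \<comment> \<open>Squaring the lower bound and using
    \<open>norm (B (B x)) \<le> l * norm (B x)\<close> improves the bound \<open>l\<close> for
    \<open>B\<close> strictly, contrary to \<open>l = norm B\<close>.\<close>
  have est: "(norm (B x))\<^sup>2 \<le> (l\<^sup>2 - (c / l)\<^sup>2) * (norm x)\<^sup>2" for x
  proof -
    have "c\<^sup>2 * (norm x)\<^sup>2 \<le> (norm (B (B x) - l\<^sup>2 *\<^sub>R x))\<^sup>2"
      using power_mono[OF below[of x], of 2] c by (simp add: power_mult_distrib l_def)
    also have "\<dots> = (norm (B (B x)))\<^sup>2 - 2 * l\<^sup>2 * (norm (B x))\<^sup>2 + (l\<^sup>2)\<^sup>2 * (norm x)\<^sup>2"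
      unfolding power2_norm_eq_inner
      by (simp add: inner_diff_left inner_diff_right self_adjointD[OF sa] inner_commute
          power2_eq_square algebra_simps)
    also have "(norm (B (B x)))\<^sup>2 \<le> l\<^sup>2 * (norm (B x))\<^sup>2"
      using power_mono[OF norm_blinfun[of B "B x"], of 2] by (simp add: l_def power_mult_distrib)
    finally have "l\<^sup>2 * (norm (B x))\<^sup>2 \<le> l\<^sup>2 * ((l\<^sup>2 - (c / l)\<^sup>2) * (norm x)\<^sup>2)"
      using l by (simp add: power_divide right_diff_distrib left_diff_distrib power2_eq_square)
    then show ?thesis using l by (simp only: mult_le_cancel_left_pos zero_less_power)
  qed
  have "0 \<le> l\<^sup>2 - (c / l)\<^sup>2"
    using order_trans[OF zero_le_power2 est[of x]] x by (simp add: zero_le_mult_iff)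
  then have "norm (B x) \<le> sqrt (l\<^sup>2 - (c / l)\<^sup>2) * norm x" for x
    using real_le_rsqrt[OF est] by (simp add: real_sqrt_mult)
  then have "norm B \<le> sqrt (l\<^sup>2 - (c / l)\<^sup>2)"
    using \<open>0 \<le> l\<^sup>2 - (c / l)\<^sup>2\<close> by (intro norm_blinfun_bound) auto
  also have "\<dots> < sqrt (l\<^sup>2)" using c l by (intro real_sqrt_less_mono) simp
  finally show False using l by (simp add: l_def)
qed

text \<open>Over an empty spectrum every nonzero polynomial of \<open>A\<close> is bounded below,
  also the square of \<open>A\<close> minus \<open>(norm A)\<^sup>2\<close>. This settles the
  degenerate case of the norm bound.\<close>

lemma op_spectrum_empty_trivial:
  fixes A :: "'a::{real_inner, complete_space} \<Rightarrow>\<^sub>L 'a" and x :: 'a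
  assumes "self_adjoint A" "op_spectrum A = {}"
  shows "x = 0"
proof -
  obtain c where "c > 0" "\<And>x. c * norm x \<le> norm (op_poly [:- (norm A)\<^sup>2, 0, 1:] A x)"
    using op_poly_bounded_below[OF assms(1), of "[:- (norm A)\<^sup>2, 0, 1:]"] assms(2) by auto
  then show ?thesis
    by (intro self_adjoint_square_bounded_below_trivial[OF assms(1), of c])
      (simp_all add: blinfun.zero_right)
qed

lemma norm_op_poly_le:
  fixes A :: "'a::{real_inner, complete_space} \<Rightarrow>\<^sub>L 'a"
  assumes sa: "self_adjoint A" and M: "0 \<le> M" "\<And>t. t \<in> op_spectrum A \<Longrightarrow> \<bar>poly p t\<bar> \<le> M"
  shows "norm (op_poly p A) \<le> M"
proof (rule ccontr)
  define l where "l = norm (op_poly p A)"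
  assume "\<not> ?thesis"
  then have l: "M < l" by (simp add: l_def)
  define q where "q = p * p - [:l\<^sup>2:]"
  have q: "poly q t \<noteq> 0" if "t \<in> op_spectrum A" for t
  proof -
    have "(poly p t)\<^sup>2 < l\<^sup>2"
      using power_strict_mono[of "\<bar>poly p t\<bar>" l 2] M(2)[OF that] l by simp
    then show ?thesis by (simp add: q_def power2_eq_square)
  qed
  \<comment> \<open>If \<open>q\<close> is the zero polynomial, the spectrum must be empty. In both
    cases the space is trivial, so \<open>l = 0\<close>, which contradicts
    \<open>0 \<le> M < l\<close>.\<close>
  have "x = 0" for x :: 'a
  proof (cases "q = 0")
    case True
    then have "op_spectrum A = {}" using q by auto
    then show ?thesis using op_spectrum_empty_trivial[OF sa] by blast
  next
    case False
    then obtain c where "c > 0" "\<And>x. c * norm x \<le> norm (op_poly q A x)"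
      using op_poly_bounded_below[OF sa] q by blast
    then show ?thesis
      by (intro self_adjoint_square_bounded_below_trivial[OF self_adjoint_op_poly[OF sa, of p], of c])
        (simp_all add: q_def l_def blinfun.zero_right)
  qed
  then have "op_poly p A x = 0" for x by blast
  then have "norm (op_poly p A) \<le> 0" by (intro norm_blinfun_bound) auto
  then show False using l M(1) by (simp add: l_def)
qed

text \<open>On the spectrum \<open>p\<close> ranges in \<open>[0, M]\<close>, so
  \<open>p - M / 2\<close> is at most \<open>M / 2\<close> in modulus; the norm bound for this
  shifted polynomial yields positivity.\<close>

lemma op_poly_nonneg:
  fixes A :: "'a::{real_inner, complete_space} \<Rightarrow>\<^sub>L 'a"
  assumes sa: "self_adjoint A" and nonneg: "\<And>t. t \<in> op_spectrum A \<Longrightarrow> 0 \<le> poly p t"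
  shows "0 \<le> op_poly p A x \<bullet> x"
proof -
  have "compact (poly p ` {- norm A..norm A})"
    by (intro compact_continuous_image continuous_intros) auto
  then obtain M where M: "\<forall>y\<in>poly p ` {- norm A..norm A}. norm y \<le> M"
    using compact_imp_bounded bounded_iff by blast
  have le_M: "poly p t \<le> M" if "t \<in> op_spectrum A" for t
    using M op_spectrum_abs_le_norm[OF sa that] by (auto simp: abs_le_iff)
  have "norm (poly p 0) \<le> M" using M by auto
  then have "0 \<le> M" using norm_ge_zero order_trans by blast
  have "norm (op_poly (p - [:M / 2:]) A) \<le> M / 2"
  proof (rule norm_op_poly_le[OF sa])
    show "\<bar>poly (p - [:M / 2:]) t\<bar> \<le> M / 2" if "t \<in> op_spectrum A" for t
      using nonneg[OF that] le_M[OF that] unfolding abs_le_iff by simp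
  qed (use \<open>0 \<le> M\<close> in simp)
  then have "norm (op_poly (p - [:M / 2:]) A x) * norm x \<le> M / 2 * norm x * norm x"
    by (intro mult_right_mono order_trans[OF norm_blinfun]) auto
  then have "\<bar>op_poly (p - [:M / 2:]) A x \<bullet> x\<bar> \<le> M / 2 * (norm x)\<^sup>2"
    using Cauchy_Schwarz_ineq2[of "op_poly (p - [:M / 2:]) A x" x]
    by (simp add: power2_eq_square mult.assoc)
  then have "- (M / 2 * (norm x)\<^sup>2) \<le> op_poly (p - [:M / 2:]) A x \<bullet> x" by linarith
  then show ?thesis
    by (simp add: inner_diff_left blinfun.zero_right power2_norm_eq_inner)
qed

text \<open>Positivity of \<open>c\<^sup>2 q\<^sup>2 - p\<^sup>2\<close> on the spectrum. Comparison
  on vectors takes the place of dividing by \<open>q\<close>.\<close>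

lemma norm_op_poly_mono:
  fixes A :: "'a::{real_inner, complete_space} \<Rightarrow>\<^sub>L 'a"
  assumes sa: "self_adjoint A" and c: "0 \<le> c"
    and le: "\<And>t. t \<in> op_spectrum A \<Longrightarrow> \<bar>poly p t\<bar> \<le> c * \<bar>poly q t\<bar>"
  shows "norm (op_poly p A x) \<le> c * norm (op_poly q A x)"
proof -
  have "0 \<le> op_poly (smult (c\<^sup>2) (q * q) - p * p) A x \<bullet> x"
  proof (rule op_poly_nonneg[OF sa])
    fix t assume "t \<in> op_spectrum A"
    then have "(poly p t)\<^sup>2 \<le> (c * poly q t)\<^sup>2"
      using le[of t] c by (simp add: abs_le_square_iff[symmetric] abs_mult)
    then show "0 \<le> poly (smult (c\<^sup>2) (q * q) - p * p) t"
      by (simp add: power2_eq_square algebra_simps)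
  qed
  then have "(norm (op_poly p A x))\<^sup>2 \<le> (c * norm (op_poly q A x))\<^sup>2"
    by (simp add: inner_diff_left self_adjointD[OF self_adjoint_op_poly[OF sa]]
        power2_norm_eq_inner power_mult_distrib)
  then show ?thesis by (rule power2_le_imp_le) (simp add: c)
qed

section \<open>Continuous functional calculus\<close>

text \<open>A type of sort \<open>{real_inner, complete_space}\<close> is not of class \<open>banach\<close>, so the library's
  completeness of \<open>\<Rightarrow>\<^sub>L\<close> does not apply.\<close>

lemma Cauchy_blinfun_convergent:
  fixes X :: "nat \<Rightarrow> 'a::real_normed_vector \<Rightarrow>\<^sub>L 'b::{real_normed_vector, complete_space}"
  assumes "Cauchy X"
  shows "convergent X"
proof -
  have "Cauchy (\<lambda>n. X n x)" for x
    using assms by (rule bounded_linear.Cauchy[OF blinfun.bounded_linear_left])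
  then have "\<exists>l. (\<lambda>n. X n x) \<longlonglongrightarrow> l" for x
    using Cauchy_convergent convergent_def by blast
  then obtain g where g: "\<And>x. (\<lambda>n. X n x) \<longlonglongrightarrow> g x" by metis
  obtain K where K: "\<And>n. norm (X n) \<le> K"
    using Cauchy_Bseq[OF assms] by (auto simp: Bseq_def)
  have "bounded_linear g"
  proof
    show "g (x + y) = g x + g y" for x y
      using g[of "x + y"] tendsto_add[OF g[of x] g[of y]]
      by (intro LIMSEQ_unique) (simp_all add: blinfun.add_right)
    show "g (r *\<^sub>R x) = r *\<^sub>R g x" for r x
      using g[of "r *\<^sub>R x"] tendsto_scaleR[OF tendsto_const g[of x], of r]
      by (intro LIMSEQ_unique) (simp_all add: blinfun.scaleR_right)
    have "norm (g x) \<le> norm x * K" for x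
    proof (rule Lim_bounded[OF tendsto_norm[OF g]])
      show "\<forall>n\<ge>0. norm (X n x) \<le> norm x * K"
        using order_trans[OF norm_blinfun mult_right_mono[OF K norm_ge_zero]]
        by (simp add: mult.commute)
    qed
    then show "\<exists>K. \<forall>x. norm (g x) \<le> norm x * K" by blast
  qed
  then have G: "blinfun_apply (Blinfun g) = g" by (rule bounded_linear_Blinfun_apply)
  have "X \<longlonglongrightarrow> Blinfun g"
  proof (rule metric_LIMSEQ_I)
    fix e :: real assume e: "0 < e"
    then obtain M where M: "\<And>m n. m \<ge> M \<Longrightarrow> n \<ge> M \<Longrightarrow> dist (X m) (X n) < e / 2"
      using metric_CauchyD[OF assms, of "e / 2"] by auto
    have "dist (X n) (Blinfun g) < e" if n: "n \<ge> M" for n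
    proof -
      have "norm ((X n - Blinfun g) x) \<le> e / 2 * norm x" for x
      proof (rule Lim_bounded)
        show "(\<lambda>m. norm (X n x - X m x)) \<longlonglongrightarrow> norm ((X n - Blinfun g) x)"
          by (simp add: blinfun.diff_left G) (intro tendsto_intros g)
        show "\<forall>m\<ge>M. norm (X n x - X m x) \<le> e / 2 * norm x"
        proof (intro allI impI)
          fix m assume "m \<ge> M"
          then have "norm (X n - X m) \<le> e / 2" using M[OF n] by (simp add: dist_norm less_imp_le)
          then have "norm ((X n - X m) x) \<le> e / 2 * norm x"
            by (intro order_trans[OF norm_blinfun] mult_right_mono) auto
          then show "norm (X n x - X m x) \<le> e / 2 * norm x" by (simp add: blinfun.diff_left)
        qed
      qed
      then have "norm (X n - Blinfun g) \<le> e / 2"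
        using e by (intro norm_blinfun_bound) auto
      then show ?thesis using e by (simp add: dist_norm)
    qed
    then show "\<exists>M. \<forall>n\<ge>M. dist (X n) (Blinfun g) < e" by blast
  qed
  then show ?thesis by (rule convergentI)
qed

lemma op_poly_diff_blinfun: "op_poly (p - q) A = op_poly p A - op_poly q A"
  by (rule blinfun_eqI) (simp add: blinfun.diff_left)

text \<open>\<open>norm_op_poly_le\<close> turns uniform closeness on the spectrum into closeness in
  operator norm.\<close>

lemma op_poly_convergent:
  fixes A :: "'a::{real_inner, complete_space} \<Rightarrow>\<^sub>L 'a"
  assumes sa: "self_adjoint A"
    and lim: "uniform_limit (op_spectrum A) (\<lambda>n. poly (p n)) f sequentially"
  shows "convergent (\<lambda>n. op_poly (p n) A)"
proof (rule Cauchy_blinfun_convergent, rule metric_CauchyI)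
  fix e :: real assume e: "0 < e"
  then have "\<forall>\<^sub>F n in sequentially. \<forall>t\<in>op_spectrum A. dist (poly (p n) t) (f t) < e / 4"
    using uniform_limitD[OF lim, of "e / 4"] by simp
  then obtain M where M: "\<And>n t. n \<ge> M \<Longrightarrow> t \<in> op_spectrum A \<Longrightarrow> \<bar>poly (p n) t - f t\<bar> < e / 4"
    by (auto simp: eventually_sequentially dist_real_def)
  have "dist (op_poly (p m) A) (op_poly (p n) A) < e" if "m \<ge> M" "n \<ge> M" for m n
  proof -
    have "norm (op_poly (p m - p n) A) \<le> e / 2"
    proof (rule norm_op_poly_le[OF sa])
      show "\<bar>poly (p m - p n) t\<bar> \<le> e / 2" if "t \<in> op_spectrum A" for t
        using M[OF \<open>m \<ge> M\<close> that] M[OF \<open>n \<ge> M\<close> that] unfolding poly_diff by linarith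
    qed (use e in simp)
    then show ?thesis using e by (simp add: dist_norm op_poly_diff_blinfun)
  qed
  then show "\<exists>M. \<forall>m\<ge>M. \<forall>n\<ge>M. dist (op_poly (p m) A) (op_poly (p n) A) < e" by blast
qed

text \<open>Makes the limit in \<open>fun_calc\<close> independent of the approximating sequence:
  differences of two such sequences tend to zero uniformly on the spectrum.\<close>

lemma op_poly_limit_unique:
  fixes A :: "'a::{real_inner, complete_space} \<Rightarrow>\<^sub>L 'a"
  assumes sa: "self_adjoint A"
    and p: "uniform_limit (op_spectrum A) (\<lambda>n. poly (p n)) f sequentially"
    and q: "uniform_limit (op_spectrum A) (\<lambda>n. poly (q n)) f sequentially"
    and B: "(\<lambda>n. op_poly (p n) A) \<longlonglongrightarrow> B"
  shows "(\<lambda>n. op_poly (q n) A) \<longlonglongrightarrow> B"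
proof -
  have "(\<lambda>n. op_poly (q n - p n) A) \<longlonglongrightarrow> 0"
  proof (rule LIMSEQ_I)
    fix e :: real assume e: "0 < e"
    have "\<forall>\<^sub>F n in sequentially. (\<forall>t\<in>op_spectrum A. dist (poly (p n) t) (f t) < e / 4)
        \<and> (\<forall>t\<in>op_spectrum A. dist (poly (q n) t) (f t) < e / 4)"
      using uniform_limitD[OF p, of "e / 4"] uniform_limitD[OF q, of "e / 4"] e
      by (simp add: eventually_conj_iff)
    then obtain M where M: "\<And>n t. n \<ge> M \<Longrightarrow> t \<in> op_spectrum A \<Longrightarrow>
        \<bar>poly (p n) t - f t\<bar> < e / 4 \<and> \<bar>poly (q n) t - f t\<bar> < e / 4"
      by (auto simp: eventually_sequentially dist_real_def)
    have "norm (op_poly (q n - p n) A - 0) < e" if "n \<ge> M" for n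
    proof -
      have "norm (op_poly (q n - p n) A) \<le> e / 2"
      proof (rule norm_op_poly_le[OF sa])
        show "\<bar>poly (q n - p n) t\<bar> \<le> e / 2" if "t \<in> op_spectrum A" for t
          using M[OF \<open>n \<ge> M\<close> that] unfolding poly_diff by linarith
      qed (use e in simp)
      then show ?thesis using e by simp
    qed
    then show "\<exists>M. \<forall>n\<ge>M. norm (op_poly (q n - p n) A - 0) < e" by blast
  qed
  from tendsto_add[OF this B] show ?thesis by (simp add: op_poly_diff_blinfun)
qed

lemma Weierstrass_real_poly:
  fixes f :: "real \<Rightarrow> real"
  assumes "continuous_on {a..b} f"
  obtains p where "uniform_limit {a..b} (\<lambda>n. poly (p n)) f sequentially"
proof -
  have "\<exists>p. \<forall>t\<in>{a..b}. \<bar>f t - poly p t\<bar> < inverse (real (Suc n))" for n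
  proof -
    obtain g where g: "real_polynomial_function g"
        "\<And>t. t \<in> {a..b} \<Longrightarrow> \<bar>f t - g t\<bar> < inverse (real (Suc n))"
      using Stone_Weierstrass_real_polynomial_function[OF _ assms, of "inverse (real (Suc n))"] by auto
    obtain c k where "g = (\<lambda>x. \<Sum>i\<le>k. c i * x ^ i)"
      using real_polynomial_function_imp_sum[OF g(1)] by blast
    then have "g t = poly (\<Sum>i\<le>k. monom (c i) i) t" for t
      by (simp add: poly_sum poly_monom)
    then show ?thesis using g(2) by metis
  qed
  then obtain p where p: "\<And>n t. t \<in> {a..b} \<Longrightarrow> \<bar>f t - poly (p n) t\<bar> < inverse (real (Suc n))"
    by metis
  have "uniform_limit {a..b} (\<lambda>n. poly (p n)) f sequentially"
  proof (rule uniform_limitI)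
    fix e :: real assume "0 < e"
    then have "\<forall>\<^sub>F n in sequentially. inverse (real (Suc n)) < e"
      using LIMSEQ_inverse_real_of_nat by (rule order_tendstoD(2)[rotated])
    then show "\<forall>\<^sub>F n in sequentially. \<forall>t\<in>{a..b}. dist (poly (p n) t) (f t) < e"
      by eventually_elim
        (use p in \<open>force simp: dist_real_def abs_minus_commute intro: less_trans\<close>)
  qed
  then show ?thesis by (rule that)
qed

lemma fun_calc_approx:
  fixes A :: "'a::{real_inner, complete_space} \<Rightarrow>\<^sub>L 'a"
  assumes sa: "self_adjoint A" and spec: "op_spectrum A \<subseteq> {a..b}"
    and cont: "continuous_on {a..b} f"
  obtains p where "uniform_limit {a..b} (\<lambda>n. poly (p n)) f sequentially"
    and "(\<lambda>n. op_poly (p n) A) \<longlonglongrightarrow> fun_calc f A"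
proof -
  obtain p where p: "uniform_limit {a..b} (\<lambda>n. poly (p n)) f sequentially"
    using Weierstrass_real_poly[OF cont] by blast
  have p': "uniform_limit (op_spectrum A) (\<lambda>n. poly (p n)) f sequentially"
    using p spec by (rule uniform_limit_on_subset)
  obtain B where B: "(\<lambda>n. op_poly (p n) A) \<longlonglongrightarrow> B"
    using op_poly_convergent[OF sa p'] convergent_def by blast
  \<comment> \<open>Uniqueness needs one approximating sequence, here \<open>p\<close>; otherwise
    the implication under \<open>THE\<close> would hold vacuously for every operator.\<close>
  have "fun_calc f A = B"
    unfolding fun_calc_def
    by (rule the_equality) (use op_poly_limit_unique[OF sa p' _ B] p' B LIMSEQ_unique in blast)+
  with p B show ?thesis using that by blast
qed

section \<open>Polynomials of the Riccati recursion\<close>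

text \<open>
  Denominator \<open>q\<close> and numerator \<open>r\<close> of the \<open>m\<close>-th iterate of \<open>w \<mapsto> w / (1 + w) + t\<close> from \<open>w = t\<close>.
\<close>

fun den_poly num_poly :: "nat \<Rightarrow> real poly" where
  "den_poly 0 = 1"
| "num_poly 0 = [:0, 1:]"
| "den_poly (Suc m) = den_poly m + num_poly m"
| "num_poly (Suc m) = num_poly m + [:0, 1:] * (den_poly m + num_poly m)"

lemma den_num_poly_bounds:
  assumes "0 \<le> t"
  shows "1 \<le> poly (den_poly m) t" "0 \<le> poly (num_poly m) t"
proof -
  have "1 \<le> poly (den_poly m) t \<and> 0 \<le> poly (num_poly m) t"
    using assms by (induction m) (auto intro: add_increasing2 add_nonneg_nonneg mult_nonneg_nonneg)
  then show "1 \<le> poly (den_poly m) t" "0 \<le> poly (num_poly m) t" by auto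
qed

text \<open>The ratio \<open>w\<close> of numerator to denominator evolves by
  \<open>w / (1 + w) + s\<^sup>2\<close>, and \<open>w \<le> s\<^sup>2 + s\<close> forces
  \<open>w / (1 + w) \<le> s\<close>, so the bound persists.\<close>

lemma num_poly_le_den_poly:
  assumes s: "0 \<le> s"
  shows "poly (num_poly m) (s\<^sup>2) \<le> (s\<^sup>2 + s) * poly (den_poly m) (s\<^sup>2)"
proof (induction m)
  case (Suc m)
  define q r where "q = poly (den_poly m) (s\<^sup>2)" and "r = poly (num_poly m) (s\<^sup>2)"
  have q: "0 \<le> q" and r: "0 \<le> r"
    using den_num_poly_bounds[of "s\<^sup>2" m] by (auto simp: q_def r_def)
  have "r \<le> s * (q + r)"
  proof (cases "s \<ge> 1")
    case True
    then have "1 * r \<le> s * (q + r)" using q r s by (intro mult_mono) auto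
    then show ?thesis by simp
  next
    case False
    then have "r * (1 - s) \<le> (s\<^sup>2 + s) * q * (1 - s)"
      using Suc by (intro mult_right_mono) (auto simp: q_def r_def)
    also have "\<dots> = s * q - s * s\<^sup>2 * q" by (simp add: algebra_simps power2_eq_square)
    also have "\<dots> \<le> s * q" using s q by simp
    finally show ?thesis by (simp add: algebra_simps)
  qed
  then show ?case by (simp add: q_def[symmetric] r_def[symmetric] algebra_simps)
qed (use s in simp)

text \<open>The linear form \<open>s q + r\<close> grows at least by the factor \<open>1 + s\<close> in each step of the recursion.\<close>

lemma den_poly_growth:
  assumes s: "0 \<le> s"
  shows "(1 + s) ^ m \<le> 2 * poly (den_poly m) (s\<^sup>2)"
proof (cases "s = 0")
  case True
  then show ?thesis using den_num_poly_bounds(1)[of 0 m] by simp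
next
  case False
  with s have s': "0 < s" by simp
  \<comment> \<open>For \<open>m = 0\<close> both sides are \<open>s * (1 + s)\<close>, hence the
    exponent \<open>Suc m\<close>.\<close>
  have "s * (1 + s) ^ Suc m \<le> s * poly (den_poly m) (s\<^sup>2) + poly (num_poly m) (s\<^sup>2)"
  proof (induction m)
    case (Suc m)
    define q r where "q = poly (den_poly m) (s\<^sup>2)" and "r = poly (num_poly m) (s\<^sup>2)"
    have r: "0 \<le> r" using den_num_poly_bounds[of "s\<^sup>2" m] by (auto simp: r_def)
    have "s * (1 + s) ^ Suc (Suc m) = (1 + s) * (s * (1 + s) ^ Suc m)" by simp
    also have "\<dots> \<le> (1 + s) * (s * q + r)"
      using Suc s by (intro mult_left_mono) (auto simp: q_def r_def)
    also have "\<dots> \<le> s * (q + r) + (r + s\<^sup>2 * (q + r))"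
      using r by (simp add: algebra_simps power2_eq_square)
    finally show ?case by (simp add: q_def r_def)
  qed (simp add: power2_eq_square algebra_simps)
  \<comment> \<open>Trading the numerator for the denominator leaves the factor
    \<open>2 + s \<le> 2 * (1 + s)\<close>; it costs the 2 and the extra power of
    \<open>1 + s\<close>.\<close>
  also have "\<dots> \<le> s * poly (den_poly m) (s\<^sup>2) + (s\<^sup>2 + s) * poly (den_poly m) (s\<^sup>2)"
    using num_poly_le_den_poly[OF s, of m] by simp
  also have "\<dots> = s * ((2 + s) * poly (den_poly m) (s\<^sup>2))"
    by (simp add: power2_eq_square algebra_simps)
  finally have "(1 + s) * (1 + s) ^ m \<le> (2 + s) * poly (den_poly m) (s\<^sup>2)"
    using s' by simp
  also have "\<dots> \<le> (2 * (1 + s)) * poly (den_poly m) (s\<^sup>2)"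
    using s den_num_poly_bounds(1)[of "s\<^sup>2" m] by (intro mult_right_mono) auto
  also have "\<dots> = (1 + s) * (2 * poly (den_poly m) (s\<^sup>2))" by simp
  finally show ?thesis by (rule mult_left_le_imp_le) (use s in simp)
qed

text \<open>Raise \<open>w \<le> exp w\<close> to the power \<open>a\<close> and use
  \<open>s / (1 + S) \<le> ln (1 + s)\<close> on \<open>[0, S]\<close>.\<close>

lemma powr_le_power_one_plus:
  fixes s S a :: real
  assumes "0 < a" "0 \<le> s" "s \<le> S"
  shows "(real n * s) powr a \<le> (a * (1 + S)) powr a * (1 + s) ^ n"
proof -
  \<comment> \<open>Chosen so that \<open>a * w = real n * (s / (1 + S))\<close>.\<close>
  define k where "k = a * (1 + S)"
  have k: "0 < k" using assms by (simp add: k_def)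
  define w where "w = real n * s / k"
  have w: "0 \<le> w" using assms k by (simp add: w_def)
  have "s / (1 + S) \<le> s / (1 + s)"
    using assms by (intro divide_left_mono) auto
  also have "\<dots> \<le> ln (1 + s)"
    using ln_le_minus_one[of "1 / (1 + s)"] assms by (simp add: ln_div field_simps)
  finally have ln: "s / (1 + S) \<le> ln (1 + s)" .
  have "w \<le> exp w" using exp_ge_add_one_self[of w] by linarith
  then have "w powr a \<le> exp w powr a"
    using w assms by (intro powr_mono2) auto
  also have "\<dots> = exp (real n * (s / (1 + S)))"
    using assms by (simp add: powr_def w_def k_def)
  also have "\<dots> \<le> exp (real n * ln (1 + s))"
    unfolding exp_le_cancel_iff by (intro mult_left_mono ln) simp
  also have "\<dots> = (1 + s) ^ n"
    using assms by (simp add: exp_of_nat_mult)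
  finally have "k powr a * w powr a \<le> k powr a * (1 + s) ^ n"
    by (intro mult_left_mono) auto
  also have "k powr a * w powr a = (real n * s) powr a"
    using k w by (subst powr_mult[symmetric]) (auto simp: w_def)
  finally show ?thesis by (simp add: k_def)
qed

text \<open>Exponential growth in \<open>s = sqrt t\<close> beats the power \<open>2 * \<mu>\<close>
  of \<open>n * s\<close>. The product form is what \<open>norm_op_poly_mono\<close> takes.\<close>

lemma powr_le_den_poly:
  assumes "0 < \<mu>" "0 \<le> t" "t \<le> L" "n \<ge> 1"
  shows "t powr \<mu> \<le> 2 * (2 * \<mu> * (1 + sqrt L)) powr (2 * \<mu>) * real n powr (- 2 * \<mu>)
           * poly (den_poly n) t"
proof -
  define K where "K = (2 * \<mu> * (1 + sqrt L)) powr (2 * \<mu>)"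
  have "(real n * sqrt t) powr (2 * \<mu>) \<le> K * (1 + sqrt t) ^ n"
    unfolding K_def using assms by (intro powr_le_power_one_plus) auto
  also have "\<dots> \<le> K * (2 * poly (den_poly n) ((sqrt t)\<^sup>2))"
    unfolding K_def using assms by (intro mult_left_mono den_poly_growth) auto
  finally have "real n powr (2 * \<mu>) * sqrt t powr (2 * \<mu>) \<le> 2 * K * poly (den_poly n) t"
    using assms by (simp add: powr_mult)
  moreover have "sqrt t powr (2 * \<mu>) = t powr \<mu>"
    using assms by (simp add: powr_half_sqrt[symmetric] powr_powr)
  ultimately have "real n powr (- 2 * \<mu>) * (real n powr (2 * \<mu>) * t powr \<mu>)
      \<le> real n powr (- 2 * \<mu>) * (2 * K * poly (den_poly n) t)"
    by (intro mult_left_mono) auto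
  moreover have "real n powr (- 2 * \<mu>) * (real n powr (2 * \<mu>) * t powr \<mu>) = t powr \<mu>"
    using assms(4) by (simp add: mult.assoc[symmetric] powr_add[symmetric])
  ultimately have "t powr \<mu> \<le> real n powr (- 2 * \<mu>) * (2 * K * poly (den_poly n) t)"
    by (simp only:)
  then show ?thesis by (simp only: K_def mult_ac)
qed

section \<open>The iteration\<close>

definition positive_op :: "('a::real_inner \<Rightarrow>\<^sub>L 'a) \<Rightarrow> bool" where
  "positive_op S \<longleftrightarrow> self_adjoint S \<and> (\<forall>x. 0 \<le> S x \<bullet> x)"

lemma positive_opD:
  assumes "positive_op S"
  shows "S x \<bullet> y = x \<bullet> S y" "0 \<le> S x \<bullet> x" "self_adjoint S"
  using assms by (auto simp: positive_op_def self_adjoint_def)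

lemma positive_op_id: "positive_op id_blinfun"
  by (simp add: positive_op_def self_adjoint_def)

lemma positive_op_adj_compose: "positive_op (adj F o\<^sub>L F)"
  by (simp add: positive_op_def self_adjoint_def adj_inner_left adj_inner_right)

definition riccati ::
    "('x::{real_inner, complete_space} \<Rightarrow>\<^sub>L 'y::{real_inner, complete_space})
      \<Rightarrow> ('y \<Rightarrow>\<^sub>L 'y) \<Rightarrow> ('y \<Rightarrow>\<^sub>L 'y)" where
  "riccati F S = (adj (id_blinfun - (F o\<^sub>L gain F S)) o\<^sub>L S o\<^sub>L (id_blinfun - (F o\<^sub>L gain F S)))
     + (adj (gain F S) o\<^sub>L gain F S) + id_blinfun"

lemma S_op_terminal: "S_op F N N = id_blinfun"
  by (simp add: S_op.simps)

lemma S_op_riccati: "k < N \<Longrightarrow> S_op F N k = riccati F (S_op F N (Suc k))"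
  by (subst S_op.simps) (simp add: riccati_def Let_def)

text \<open>Positivity of \<open>S\<close> makes \<open>M\<close> coercive with constant 1, so
  \<open>op_inverse M\<close> is a true inverse; the equation is the normal equation of the one-step
  minimisation.\<close>

lemma gain_equation:
  fixes F :: "'x::{real_inner, complete_space} \<Rightarrow>\<^sub>L 'y::{real_inner, complete_space}"
  assumes "positive_op S"
  shows "gain F S e + adj F (S (F (gain F S e))) = adj F (S e)"
proof -
  define M where "M = (adj F o\<^sub>L S o\<^sub>L F) + id_blinfun"
  have coercive: "1 * (norm x)\<^sup>2 \<le> M x \<bullet> x" for x
    using positive_opD(2)[OF assms, of "F x"]
    by (simp add: M_def blinfun.add_left inner_add_left adj_inner_left power2_norm_eq_inner)
  have "1 * norm x \<le> norm (M x)" for x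
  proof (cases "x = 0")
    case False
    have "norm x * norm x \<le> norm (M x) * norm x"
      using order_trans[OF coercive norm_cauchy_schwarz, of x] by (simp add: power2_eq_square)
    then have "norm x \<le> norm (M x)"
      by (rule mult_right_le_imp_le) (use False in simp)
    then show ?thesis by simp
  qed simp
  then have "M (op_inverse M x) = x" for x
    by (intro op_inverse_right[of 1] coercive_imp_surj[of 1, OF _ coercive]) auto
  from this[of "adj F (S e)"] show ?thesis
    by (simp add: gain_def M_def[symmetric]) (simp add: M_def blinfun.add_left add.commute)
qed

lemma riccati_inner:
  "riccati F S e \<bullet> e' = S (e - F (gain F S e)) \<bullet> (e' - F (gain F S e'))
     + gain F S e \<bullet> gain F S e' + e \<bullet> e'"
  by (simp add: riccati_def blinfun.add_left blinfun.diff_left inner_add_left adj_inner_left)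

lemma positive_op_riccati:
  assumes "positive_op S"
  shows "positive_op (riccati F S)"
proof -
  have "riccati F S x \<bullet> y = x \<bullet> riccati F S y" for x y
    unfolding inner_commute[of x "riccati F S y"] riccati_inner
    using positive_opD(1)[OF assms] by (simp add: inner_commute)
  moreover have "0 \<le> riccati F S x \<bullet> x" for x
    unfolding riccati_inner using positive_opD(2)[OF assms] by simp
  ultimately show ?thesis by (simp add: positive_op_def self_adjoint_def)
qed

lemma positive_op_S_op: "positive_op (S_op F N k)"
proof (induction "N - k" arbitrary: k)
  case 0
  then show ?case by (simp add: S_op.simps positive_op_id)
next
  case (Suc n)
  then show ?case by (simp add: S_op_riccati positive_op_riccati)
qed

text \<open>\<open>- gain F S e\<close> minimises \<open>v \<mapsto> \<langle>S (e + F v), e + F v\<rangle> + \<parallel>v\<parallel>\<^sup>2 + \<parallel>e\<parallel>\<^sup>2\<close>, so its value is at most that at \<open>v = 0\<close>.\<close>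

lemma riccati_le:
  assumes S: "positive_op S"
  shows "riccati F S e \<bullet> e \<le> S e \<bullet> e + (norm e)\<^sup>2"
proof -
  define v where "v = gain F S e"
  define a where "a = S (F v) \<bullet> F v"
  have "v \<bullet> v + a = S e \<bullet> F v"
    using arg_cong[OF gain_equation[OF S, of F e], of "\<lambda>z. z \<bullet> v"]
    by (simp add: v_def a_def inner_add_left adj_inner_left)
  moreover have "S (e - F v) \<bullet> (e - F v) = S e \<bullet> e - 2 * (S e \<bullet> F v) + a"
    using positive_opD(1)[OF S, of "F v" e]
    by (simp add: a_def blinfun.diff_right inner_diff_left inner_diff_right inner_commute)
  moreover have "0 \<le> a" unfolding a_def by (rule positive_opD(2)[OF S])
  moreover have "0 \<le> v \<bullet> v" by (rule inner_ge_zero)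
  ultimately show ?thesis
    unfolding riccati_inner v_def[symmetric] power2_norm_eq_inner by linarith
qed

section \<open>Control cost and amplification of noise\<close>

text \<open>Counting \<open>m\<close> steps back from the terminal identity, each step adds at most
  one \<open>(norm e)\<^sup>2\<close>.\<close>

lemma S_op_le:
  assumes "m \<le> N"
  shows "S_op F N (N - m) e \<bullet> e \<le> (real m + 1) * (norm e)\<^sup>2"
  using assms
proof (induction m)
  case 0
  then show ?case by (simp add: S_op_terminal power2_norm_eq_inner)
next
  case (Suc m)
  then have "S_op F N (N - Suc m) = riccati F (S_op F N (N - m))"
    using S_op_riccati[of "N - Suc m" N F] by (simp add: Suc_diff_Suc)
  then show ?case
    using Suc riccati_le[OF positive_op_S_op, of F F N "N - m" e] by (simp add: algebra_simps)
qed

text \<open>Dynamic programming: the form of \<open>S_op\<close> at step \<open>k\<close> equals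
  that at \<open>Suc k\<close> plus the squared norms of \<open>v_step\<close> and
  \<open>eps\<close>. Dropping the latter and telescoping suffices.\<close>

lemma sum_norm_v_step_le:
  assumes "k \<le> N"
  shows "(\<Sum>j<k. (norm (v_step F N y j))\<^sup>2) + S_op F N k (eps F N y k) \<bullet> eps F N y k
    \<le> S_op F N 0 y \<bullet> y"
  using assms
proof (induction k)
  case 0
  then show ?case by (simp add: blinfun.minus_right)
next
  case (Suc k)
  define e where "e = eps F N y k"
  have "S_op F N k e \<bullet> e = S_op F N (Suc k) (eps F N y (Suc k)) \<bullet> eps F N y (Suc k)
      + (norm (v_step F N y k))\<^sup>2 + e \<bullet> e"
    using Suc.prems
    by (simp add: S_op_riccati riccati_inner v_step_def K_op_def e_def power2_norm_eq_inner
        blinfun.minus_right)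
  moreover have "0 \<le> e \<bullet> e" by (rule inner_ge_zero)
  ultimately show ?case using Suc unfolding sum.lessThan_Suc e_def by linarith
qed

lemma norm_u_iter_le:
  assumes "N \<ge> 1"
  shows "norm (u_iter F N y) \<le> 2 * real N * norm y"
proof (rule power2_le_imp_le)
  have "(norm (u_iter F N y))\<^sup>2 \<le> (\<Sum>j<N. norm (v_step F N y j))\<^sup>2"
    unfolding u_iter_def by (intro power_mono norm_sum) auto
  also have "\<dots> \<le> (\<Sum>j<N. (norm (v_step F N y j))\<^sup>2) * real (card {..<N})"
    by (rule sum_squared_le_sum_of_squares)
  also have "\<dots> \<le> ((real N + 1) * (norm y)\<^sup>2) * real (card {..<N})"
    using sum_norm_v_step_le[of N N F y] S_op_le[of N N F y]
      positive_opD(2)[OF positive_op_S_op, of F N N "eps F N y N"]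
    by (intro mult_right_mono) auto
  also have "\<dots> = ((real N + 1) * real N) * (norm y)\<^sup>2" by simp
  \<comment> \<open>From \<open>N \<ge> 1\<close> both \<open>N + 1\<close> and \<open>N\<close> are
    at most \<open>2 * N\<close>.\<close>
  also have "\<dots> \<le> ((2 * real N) * (2 * real N)) * (norm y)\<^sup>2"
    using assms by (intro mult_right_mono mult_mono) auto
  finally show "(norm (u_iter F N y))\<^sup>2 \<le> (2 * real N * norm y)\<^sup>2"
    by (simp add: power2_eq_square mult_ac)
qed simp

lemma eps_diff: "eps F N (y - z) k = eps F N y k - eps F N z k"
  by (induction k) (simp_all add: blinfun.diff_right blinfun.minus_right)

lemma u_iter_diff: "u_iter F N (y - z) = u_iter F N y - u_iter F N z"
  by (simp add: u_iter_def v_step_def eps_diff blinfun.diff_right sum_subtractf sum_negf)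

section \<open>Polynomial form of the Riccati recursion and of the error\<close>

text \<open>With \<open>W\<close> for \<open>adj F o\<^sub>L S o\<^sub>L F\<close> this reads
  \<open>(I + W) (I - K F) = I\<close>; it drives the recursions of both \<open>W\<close> and the
  error.\<close>

lemma gain_residual:
  assumes "positive_op S"
  shows "(x - gain F S (F x)) + adj F (S (F (x - gain F S (F x)))) = x"
  using gain_equation[OF assms, of F "F x"]
  by (simp add: blinfun.diff_right algebra_simps)

text \<open>Test against \<open>y\<close>: by \<open>gain_residual\<close> the \<open>S\<close> term
  becomes \<open>k \<bullet> (y - k')\<close>, whose second half cancels
  \<open>k \<bullet> k'\<close>.\<close>

lemma adj_riccati:
  assumes S: "positive_op S"
  shows "adj F (riccati F S (F x)) = gain F S (F x) + adj F (F x)"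
proof (rule vector_eq_rdot[THEN iffD1], rule allI)
  fix y
  define k k' where "k = gain F S (F x)" and "k' = gain F S (F y)"
  have k: "adj F (S (F (x - k))) = k"
    using gain_residual[OF S, of x F] by (simp add: k_def)
  have "adj F (riccati F S (F x)) \<bullet> y = S (F (x - k)) \<bullet> F (y - k') + k \<bullet> k' + F x \<bullet> F y"
    by (simp add: adj_inner_left riccati_inner k_def k'_def blinfun.diff_right)
  also have "S (F (x - k)) \<bullet> F (y - k') = k \<bullet> (y - k')"
    by (simp only: adj_inner_left[symmetric] k)
  finally show "adj F (riccati F S (F x)) \<bullet> y = (gain F S (F x) + adj F (F x)) \<bullet> y"
    by (simp add: inner_diff_right inner_add_left adj_inner_left k_def)
qed

text \<open>The quotient formula for \<open>W\<close> with its denominator cleared; \<open>m\<close>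
  counts the steps back from \<open>N\<close>.\<close>

lemma den_poly_S_op:
  assumes "m \<le> N"
  shows "op_poly (den_poly m) (adj F o\<^sub>L F) (adj F (S_op F N (N - m) (F x)))
    = op_poly (num_poly m) (adj F o\<^sub>L F) x"
  using assms
proof (induction m arbitrary: x)
  case 0
  then show ?case by (simp add: S_op_terminal one_pCons blinfun.zero_right)
next
  case (Suc m)
  define A where "A = adj F o\<^sub>L F"
  define S where "S = S_op F N (N - m)"
  define W where "W = (\<lambda>z. adj F (S (F z)))"
  have S: "positive_op S" unfolding S_def by (rule positive_op_S_op)
  have IH: "op_poly (den_poly m) A (W z) = op_poly (num_poly m) A z" for z
    using Suc by (simp add: A_def W_def S_def)
  define k where "k = gain F S (F x)"
  have W_add: "W (a + b) = W a + W b" for a b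
    by (simp add: W_def blinfun.add_right)
  have k: "k + W k = W x"
    using gain_equation[OF S, of F "F x"] by (simp add: k_def W_def)
  have "S_op F N (N - Suc m) = riccati F S"
    using Suc.prems S_op_riccati[of "N - Suc m" N F] by (simp add: S_def Suc_diff_Suc)
  then have W': "adj F (S_op F N (N - Suc m) (F x)) = k + A x"
    by (simp add: adj_riccati[OF S] k_def A_def)
  \<comment> \<open>Since \<open>num_poly m\<close> acts as \<open>den_poly m\<close> after
    \<open>W\<close>, the next denominator acts as \<open>den_poly m\<close> after
    \<open>I + W\<close>, which undoes the inverse in \<open>k\<close>.\<close>
  have "op_poly (den_poly (Suc m)) A (k + A x) = op_poly (den_poly m) A ((k + A x) + W (k + A x))"
    by (simp add: IH blinfun.add_right)
  also have "(k + A x) + W (k + A x) = W x + (A x + W (A x))"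
    using k by (simp add: W_add algebra_simps)
  also have "op_poly (den_poly m) A (W x + (A x + W (A x)))
      = op_poly (num_poly m) A x + op_poly (den_poly m + num_poly m) A (A x)"
    by (simp add: IH blinfun.add_right)
  also have "\<dots> = op_poly (num_poly (Suc m)) A x"
    by (simp add: op_poly_commute_self blinfun.add_right blinfun.zero_right)
  finally show ?case by (simp only: W' A_def)
qed

text \<open>The spectrum is nonnegative, so there \<open>den_poly\<close> dominates the constant 1;
  injectivity and surjectivity follow.\<close>

lemma norm_le_den_poly:
  fixes A :: "'a::{real_inner, complete_space} \<Rightarrow>\<^sub>L 'a"
  assumes "positive_op A"
  shows "norm x \<le> norm (op_poly (den_poly m) A x)"
proof -
  have "\<bar>poly 1 t\<bar> \<le> 1 * \<bar>poly (den_poly m) t\<bar>" if "t \<in> op_spectrum A" for t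
    using den_num_poly_bounds(1)[of t m] op_spectrum_nonneg[OF _ _ that] positive_opD[OF assms] by simp
  then have "norm (op_poly 1 A x) \<le> 1 * norm (op_poly (den_poly m) A x)"
    using positive_opD(3)[OF assms] by (intro norm_op_poly_mono) auto
  then show ?thesis by (simp add: one_pCons blinfun.zero_right)
qed

lemma den_poly_inj:
  fixes A :: "'a::{real_inner, complete_space} \<Rightarrow>\<^sub>L 'a"
  assumes "positive_op A"
  shows "inj (op_poly (den_poly m) A)"
  by (rule bounded_below_inj[of 1]) (use norm_le_den_poly[OF assms] in auto)

lemma den_poly_surj:
  fixes A :: "'a::{real_inner, complete_space} \<Rightarrow>\<^sub>L 'a"
  assumes "positive_op A"
  shows "surj (op_poly (den_poly m) A)"
  by (rule self_adjoint_bounded_below_surj[of _ 1])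
    (use norm_le_den_poly[OF assms] self_adjoint_op_poly positive_opD(3)[OF assms] in auto)

lemma den_poly_error:
  fixes F :: "'x::{real_inner, complete_space} \<Rightarrow>\<^sub>L 'y::{real_inner, complete_space}"
  shows "op_poly (den_poly N) (adj F o\<^sub>L F) (u_iter F N (F u) - u) = - u"
proof -
  define A where "A = adj F o\<^sub>L F"
  have A: "positive_op A" unfolding A_def by (rule positive_op_adj_compose)
  define E where "E = (\<lambda>k. (\<Sum>j<k. v_step F N (F u) j) - u)"
  \<comment> \<open>For exact data the residual is the image of the error \<open>E\<close>.\<close>
  have eps: "eps F N (F u) k = F (E k)" for k
  proof (induction k)
    case (Suc k)
    then show ?case
      by (simp add: E_def v_step_def blinfun.diff_right blinfun.add_right)
  qed (simp add: E_def blinfun.minus_right)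
  \<comment> \<open>The update from \<open>N - Suc m\<close> to \<open>N - m\<close> uses
    \<open>S_op\<close> at \<open>N - m\<close>, so \<open>gain_residual\<close> gives
    \<open>(I + W) E (N - m) = E (N - Suc m)\<close>; then apply \<open>den_poly m\<close>.\<close>
  have step: "op_poly (den_poly (Suc m)) A (E (N - m)) = op_poly (den_poly m) A (E (N - Suc m))"
    if "m < N" for m
  proof -
    define S where "S = S_op F N (N - m)"
    have "E (Suc k) = E k + v_step F N (F u) k" for k
      by (simp add: E_def)
    then have "E (Suc k) = E k - gain F (S_op F N (Suc k)) (F (E k))" for k
      by (simp only: v_step_def K_op_def eps diff_conv_add_uminus)
    from this[of "N - Suc m"] that have "E (N - m) = E (N - Suc m) - gain F S (F (E (N - Suc m)))"
      by (simp add: S_def Suc_diff_Suc)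
    then have "E (N - m) + adj F (S (F (E (N - m)))) = E (N - Suc m)"
      using gain_residual[of S "E (N - Suc m)" F] by (simp add: S_def positive_op_S_op)
    then have "op_poly (den_poly m) A (E (N - m)) + op_poly (den_poly m) A (adj F (S (F (E (N - m)))))
        = op_poly (den_poly m) A (E (N - Suc m))"
      by (metis blinfun.add_right)
    then show ?thesis
      using den_poly_S_op[of m N F "E (N - m)"] that by (simp add: A_def S_def)
  qed
  \<comment> \<open>Going back from \<open>E N\<close>, each \<open>step\<close> leaves a common
    factor \<open>den_poly m\<close>, cancelled by injectivity. At \<open>m = N\<close> the right
    side is \<open>E 0 = - u\<close>.\<close>
  have "op_poly (den_poly m) A (E N) = E (N - m)" if "m \<le> N" for m
    using that
  proof (induction m)
    case 0
    then show ?case by (simp add: one_pCons blinfun.zero_right)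
  next
    case (Suc m)
    have "op_poly (den_poly m) A (op_poly (den_poly (Suc m)) A (E N))
        = op_poly (den_poly (Suc m)) A (E (N - m))"
      using Suc by (simp only: op_poly_commute[of "den_poly m"] Suc_leD)
    also have "\<dots> = op_poly (den_poly m) A (E (N - Suc m))"
      using Suc.prems by (intro step) simp
    finally show ?case by (rule injD[OF den_poly_inj[OF A]])
  qed
  from this[of N] show ?thesis by (simp add: E_def A_def u_iter_def)
qed

section \<open>Fractional powers and the rate for exact data\<close>

lemma op_powr_approx:
  fixes A :: "'a::{real_inner, complete_space} \<Rightarrow>\<^sub>L 'a"
  assumes A: "positive_op A" and \<mu>: "0 < \<mu>"
  obtains p where "uniform_limit {0..norm A} (\<lambda>n. poly (p n)) (\<lambda>t. t powr \<mu>) sequentially"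
    and "\<And>x. (\<lambda>n. op_poly (p n) A x) \<longlonglongrightarrow> op_powr A \<mu> x"
proof -
  have spec: "op_spectrum A \<subseteq> {0..norm A}"
    using op_spectrum_nonneg[of A] op_spectrum_abs_le_norm[of A] positive_opD[OF A]
    by (fastforce simp: abs_le_iff)
  have "continuous_on {0..norm A} (\<lambda>t. t powr \<mu>)"
    using \<mu> by (intro continuous_on_powr' continuous_intros) auto
  then obtain p where p: "uniform_limit {0..norm A} (\<lambda>n. poly (p n)) (\<lambda>t. t powr \<mu>) sequentially"
      "(\<lambda>n. op_poly (p n) A) \<longlonglongrightarrow> op_powr A \<mu>"
    using fun_calc_approx[OF positive_opD(3)[OF A] spec] unfolding op_powr_def by blast
  from p(2) have "(\<lambda>n. op_poly (p n) A x) \<longlonglongrightarrow> op_powr A \<mu> x" for x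
    by (rule bounded_linear.tendsto[OF blinfun.bounded_linear_left])
  with p(1) show ?thesis by (rule that)
qed

lemma op_powr_commute:
  fixes A :: "'a::{real_inner, complete_space} \<Rightarrow>\<^sub>L 'a"
  assumes "positive_op A" "0 < \<mu>"
  shows "op_poly q A (op_powr A \<mu> x) = op_powr A \<mu> (op_poly q A x)"
proof -
  obtain p where p: "\<And>x. (\<lambda>n. op_poly (p n) A x) \<longlonglongrightarrow> op_powr A \<mu> x"
    using op_powr_approx[OF assms] by blast
  have "(\<lambda>n. op_poly q A (op_poly (p n) A x)) \<longlonglongrightarrow> op_poly q A (op_powr A \<mu> x)"
    by (intro blinfun.tendsto tendsto_const p)
  moreover have "(\<lambda>n. op_poly q A (op_poly (p n) A x)) \<longlonglongrightarrow> op_powr A \<mu> (op_poly q A x)"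
    using p[of "op_poly q A x"] by (simp only: op_poly_commute[of q])
  ultimately show ?thesis by (rule LIMSEQ_unique)
qed

text \<open>The scalar bound passes to the polynomial approximants with an error \<open>e\<close>,
  then to their limit, and finally \<open>e\<close> tends to zero.\<close>

lemma norm_op_powr_le:
  fixes A :: "'a::{real_inner, complete_space} \<Rightarrow>\<^sub>L 'a"
  assumes A: "positive_op A" and \<mu>: "0 < \<mu>" and n: "n \<ge> 1"
  shows "norm (op_powr A \<mu> x)
    \<le> 2 * (2 * \<mu> * (1 + sqrt (norm A))) powr (2 * \<mu>) * real n powr (- 2 * \<mu>)
        * norm (op_poly (den_poly n) A x)"
proof -
  define c where "c = 2 * (2 * \<mu> * (1 + sqrt (norm A))) powr (2 * \<mu>) * real n powr (- 2 * \<mu>)"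
  define K where "K = norm (op_poly (den_poly n) A x)"
  have c: "0 \<le> c" by (simp add: c_def)
  obtain p where unif: "uniform_limit {0..norm A} (\<lambda>n. poly (p n)) (\<lambda>t. t powr \<mu>) sequentially"
    and lim: "\<And>x. (\<lambda>n. op_poly (p n) A x) \<longlonglongrightarrow> op_powr A \<mu> x"
    using op_powr_approx[OF A \<mu>] by blast
  have "norm (op_powr A \<mu> x) \<le> (c + e) * K" if e: "0 < e" for e
  proof (rule tendsto_upperbound[OF tendsto_norm[OF lim]])
    have "\<forall>\<^sub>F k in sequentially. \<forall>t\<in>{0..norm A}. dist (poly (p k) t) (t powr \<mu>) < e"
      using uniform_limitD[OF unif e] .
    then show "\<forall>\<^sub>F k in sequentially. norm (op_poly (p k) A x) \<le> (c + e) * K"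
      unfolding K_def
    proof eventually_elim
      case (elim k)
      show ?case
      proof (rule norm_op_poly_mono)
        fix t assume t: "t \<in> op_spectrum A"
        then have t': "0 \<le> t" "t \<le> norm A"
          using op_spectrum_nonneg[of A t] op_spectrum_abs_le_norm[of A t] positive_opD[OF A]
          by (auto simp: abs_le_iff)
        define q where "q = poly (den_poly n) t"
        have q: "1 \<le> q" using den_num_poly_bounds(1)[OF t'(1)] by (simp add: q_def)
        have "\<bar>poly (p k) t - t powr \<mu>\<bar> < e" using elim t' by (simp add: dist_real_def)
        then have "\<bar>poly (p k) t\<bar> \<le> t powr \<mu> + e" using powr_ge_zero[of t \<mu>] by linarith
        \<comment> \<open>The uniform error \<open>e\<close> is absorbed because
          \<open>1 \<le> q\<close>.\<close>
        also have "\<dots> \<le> c * q + e * q"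
          using powr_le_den_poly[OF \<mu> t' n] e q by (intro add_mono) (auto simp: c_def q_def)
        finally show "\<bar>poly (p k) t\<bar> \<le> (c + e) * \<bar>poly (den_poly n) t\<bar>"
          using q by (simp add: q_def distrib_right)
      qed (use c e positive_opD(3)[OF A] in auto)
    qed
  qed simp
  then have "\<forall>k\<ge>0. norm (op_powr A \<mu> x) \<le> (c + inverse (real (Suc k))) * K" by simp
  moreover have "(\<lambda>k. (c + inverse (real (Suc k))) * K) \<longlonglongrightarrow> (c + 0) * K"
    by (intro tendsto_intros LIMSEQ_inverse_real_of_nat)
  ultimately have "norm (op_powr A \<mu> x) \<le> (c + 0) * K"
    by (intro LIMSEQ_le_const) auto
  then show ?thesis by (simp add: c_def K_def)
qed

text \<open>Write \<open>\<omega>\<close> as \<open>den_poly N\<close> of \<open>A\<close> applied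
  to some \<open>z\<close>. Powers commute with polynomials of \<open>A\<close>, so cancelling
  \<open>den_poly N\<close> leaves the error \<open>- op_powr A \<mu> z\<close>.\<close>

lemma exact_data_rate:
  fixes F :: "'x::{real_inner, complete_space} \<Rightarrow>\<^sub>L 'y::{real_inner, complete_space}"
  assumes \<mu>: "0 < \<mu>" and u: "u = op_powr (adj F o\<^sub>L F) \<mu> \<omega>"
  obtains C where "0 \<le> C"
    and "\<And>N. N \<ge> 1 \<Longrightarrow> norm (u_iter F N (F u) - u) \<le> C * real N powr (- 2 * \<mu>)"
proof -
  define A where "A = adj F o\<^sub>L F"
  have A: "positive_op A" unfolding A_def by (rule positive_op_adj_compose)
  define C where "C = 2 * (2 * \<mu> * (1 + sqrt (norm A))) powr (2 * \<mu>) * norm \<omega>"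
  have "norm (u_iter F N (F u) - u) \<le> C * real N powr (- 2 * \<mu>)" if N: "N \<ge> 1" for N
  proof -
    obtain z where z: "op_poly (den_poly N) A z = \<omega>"
      using den_poly_surj[OF A] by (metis surjD)
    have "op_poly (den_poly N) A (u_iter F N (F u) - u) = op_poly (den_poly N) A (- op_powr A \<mu> z)"
      using den_poly_error[of N F u] op_powr_commute[OF A \<mu>, of "den_poly N" z]
      by (simp add: A_def[symmetric] u blinfun.minus_right z)
    then have "u_iter F N (F u) - u = - op_powr A \<mu> z"
      by (rule injD[OF den_poly_inj[OF A]])
    then show ?thesis
      using norm_op_powr_le[OF A \<mu> N, of z] by (simp add: z C_def mult_ac)
  qed
  then show ?thesis by (intro that[of C]) (auto simp: C_def)
qed

section \<open>Noisy data and the choice of \<open>N\<close>\<close>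

theorem theorem3p6:
  fixes F :: "'x::{real_inner, complete_space} \<Rightarrow>\<^sub>L 'y::{real_inner, complete_space}"
    and \<mu> :: real and u_dag :: 'x
  assumes "\<mu> > 0"
    and "\<exists>\<omega>. u_dag = op_powr (adj F o\<^sub>L F) \<mu> \<omega>"
  shows
    "(\<exists>C\<^sub>\<mu>::real. \<forall>N\<ge>1. norm (u_iter F N (F u_dag) - u_dag) \<le> C\<^sub>\<mu> * real N powr (- 2 * \<mu>))
     \<and>
     (\<exists>(C\<^sub>\<mu>::real) (C::real). \<forall>N\<ge>1. \<forall>(\<delta>::real) y\<^sub>\<delta>. norm (F u_dag - y\<^sub>\<delta>) \<le> \<delta> \<longrightarrow>
        norm (u_iter F N y\<^sub>\<delta> - u_dag) \<le> C\<^sub>\<mu> * real N powr (- 2 * \<mu>) + C * \<delta> * real N)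
     \<and>
     (\<forall>(c\<^sub>1::real) (c\<^sub>2::real) (N :: real \<Rightarrow> nat) (y :: real \<Rightarrow> 'y).
        c\<^sub>1 > 0 \<longrightarrow> c\<^sub>2 > 0 \<longrightarrow>
        (\<forall>\<^sub>F \<delta> in at_right 0.
           c\<^sub>1 * \<delta> powr (- 1 / (2 * \<mu> + 1)) \<le> real (N \<delta>) \<and>
           real (N \<delta>) \<le> c\<^sub>2 * \<delta> powr (- 1 / (2 * \<mu> + 1))) \<longrightarrow>
        (\<forall>\<delta>>0. norm (F u_dag - y \<delta>) \<le> \<delta>) \<longrightarrow>
        (\<lambda>\<delta>. norm (u_iter F (N \<delta>) (y \<delta>) - u_dag)) \<in> O[at_right 0](\<lambda>\<delta>. \<delta> powr (2 * \<mu> / (2 * \<mu> + 1))))"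
proof -
  obtain C where C: "0 \<le> C"
    "\<And>N. N \<ge> 1 \<Longrightarrow> norm (u_iter F N (F u_dag) - u_dag) \<le> C * real N powr (- 2 * \<mu>)"
    using assms exact_data_rate by metis
  \<comment> \<open>Additivity in the data splits off the iterate of the noise; the 2 is the
    constant of \<open>norm_u_iter_le\<close>.\<close>
  have noisy: "norm (u_iter F N y\<^sub>\<delta> - u_dag) \<le> C * real N powr (- 2 * \<mu>) + 2 * \<delta> * real N"
    if "N \<ge> 1" "norm (F u_dag - y\<^sub>\<delta>) \<le> \<delta>" for N \<delta> y\<^sub>\<delta>
  proof -
    have "norm (u_iter F N y\<^sub>\<delta> - u_iter F N (F u_dag)) \<le> 2 * real N * norm (y\<^sub>\<delta> - F u_dag)"
      unfolding u_iter_diff[symmetric] by (rule norm_u_iter_le[OF that(1)])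
    also have "\<dots> \<le> 2 * real N * \<delta>"
      using that(2) by (intro mult_left_mono) (auto simp: norm_minus_commute)
    finally show ?thesis
      using C(2)[OF that(1)]
        norm_triangle_ineq[of "u_iter F N y\<^sub>\<delta> - u_iter F N (F u_dag)" "u_iter F N (F u_dag) - u_dag"]
      by (simp add: mult_ac)
  qed
  have rate: "(\<lambda>\<delta>. norm (u_iter F (N \<delta>) (y \<delta>) - u_dag)) \<in> O[at_right 0](\<lambda>\<delta>. \<delta> powr (2 * \<mu> / (2 * \<mu> + 1)))"
    if c: "0 < c\<^sub>1" "0 < c\<^sub>2"
      and N: "\<forall>\<^sub>F \<delta> in at_right 0. c\<^sub>1 * \<delta> powr (- 1 / (2 * \<mu> + 1)) \<le> real (N \<delta>) \<and>
           real (N \<delta>) \<le> c\<^sub>2 * \<delta> powr (- 1 / (2 * \<mu> + 1))"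
      and y: "\<forall>\<delta>>0. norm (F u_dag - y \<delta>) \<le> \<delta>"
    for c\<^sub>1 c\<^sub>2 :: real and N :: "real \<Rightarrow> nat" and y :: "real \<Rightarrow> 'y"
  proof (rule bigoI)
    show "\<forall>\<^sub>F \<delta> in at_right 0. norm (norm (u_iter F (N \<delta>) (y \<delta>) - u_dag))
        \<le> (C * c\<^sub>1 powr (- 2 * \<mu>) + 2 * c\<^sub>2) * norm (\<delta> powr (2 * \<mu> / (2 * \<mu> + 1)))"
      using N eventually_at_right_less[of 0]
    proof eventually_elim
      case (elim \<delta>)
      \<comment> \<open>This scale balances the terms: \<open>p powr (- 2 * \<mu>)\<close> and
        \<open>\<delta> * p\<close> both equal
        \<open>\<delta> powr (2 * \<mu> / (2 * \<mu> + 1))\<close>. The lower bound on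
        \<open>N \<delta>\<close> controls the first term, the upper bound the second.\<close>
      define p where "p = \<delta> powr (- 1 / (2 * \<mu> + 1))"
      have \<delta>: "0 < \<delta>" by fact
      then have p: "0 < p" by (simp add: p_def)
      have N: "c\<^sub>1 * p \<le> real (N \<delta>)" "real (N \<delta>) \<le> c\<^sub>2 * p"
        using elim by (simp_all add: p_def)
      \<comment> \<open>Excludes \<open>N \<delta> = 0\<close>, where the estimates do not
        apply.\<close>
      have "0 < c\<^sub>1 * p" using c p by simp
      with N(1) have "N \<delta> \<ge> 1" by linarith
      have "real (N \<delta>) powr (- 2 * \<mu>) \<le> (c\<^sub>1 * p) powr (- 2 * \<mu>)"
        using N(1) \<open>0 < c\<^sub>1 * p\<close> assms(1) by (intro powr_mono2') auto
      also have "\<dots> = c\<^sub>1 powr (- 2 * \<mu>) * \<delta> powr (2 * \<mu> / (2 * \<mu> + 1))"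
        using c p by (simp add: powr_mult p_def powr_powr)
      finally have 1: "C * real (N \<delta>) powr (- 2 * \<mu>)
          \<le> C * (c\<^sub>1 powr (- 2 * \<mu>) * \<delta> powr (2 * \<mu> / (2 * \<mu> + 1)))"
        by (rule mult_left_mono) (rule C(1))
      have "\<delta> * p = \<delta> powr (1 + - 1 / (2 * \<mu> + 1))"
        using \<delta> unfolding p_def powr_add by simp
      also have "1 + - 1 / (2 * \<mu> + 1) = 2 * \<mu> / (2 * \<mu> + 1)"
        using assms(1) by (simp add: field_simps)
      finally have "\<delta> * p = \<delta> powr (2 * \<mu> / (2 * \<mu> + 1))" .
      moreover have "2 * \<delta> * real (N \<delta>) \<le> 2 * \<delta> * (c\<^sub>2 * p)"
        using \<delta> by (intro mult_left_mono N(2)) simp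
      ultimately have 2: "2 * \<delta> * real (N \<delta>) \<le> 2 * c\<^sub>2 * \<delta> powr (2 * \<mu> / (2 * \<mu> + 1))"
        by (metis mult.assoc mult.left_commute)
      from 1 2 noisy[OF \<open>N \<delta> \<ge> 1\<close>, of "y \<delta>" \<delta>] y \<delta> show ?case
        by (simp add: algebra_simps)
    qed
  qed
  show ?thesis
    using C(2) noisy rate by blast
qed

end
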